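(* Chattering arcs cannot occur in solutions of Problem (P): an optimal control $v$ of the equivalent optimal control problem (OC) cannot have infinitely many switchings on $[0,t_f]$.
   Context: Problem (P): given $z_0,z_f\in\mathbb R^2$, unit vectors $v_0,v_f$, and $t_f>\|z_0-z_f\|$, minimize $\operatorname{ess\,max}_{t\in[0,t_f]}\|\ddot z(t)\|$ over curves $z\in W^{2,\infty}((0,t_f),\mathbb R^2)$ with $z(0)=z_0$, $z(t_f)=z_f$, $\dot z(0)=v_0$, $\dot z(t_f)=v_f$, $\|\dot z(t)\|=1$ a.e. Equivalent Problem (OC): writing $z_0=(x_0,y_0)$, $z_f=(x_f,y_f)$, $v_0=(\cos\theta_0,\sin\theta_0)$, $v_f=(\cos\theta_f,\sin\theta_f)$, minimize $\int_0^{t_f}\alpha(t)\,dt$ over measurable controls $v$ with $|v(t)|\le1$ a.e. and states satisfying $\dot x=\cos\theta$, $\dot y=\sin\theta$, $\dot\theta=\alpha v$, $\dot\alpha=0$, with $(x,y,\theta)(0)=(x_0,y_0,\theta_0)$ and $(x,y,\theta)(t_f)=(x_f,y_f,\theta_f)$ (angles modulo $2\pi$), where $\alpha\equiv a>0$ is an unknown constant. By the maximum principle an optimal control takes (up to null sets) only the values $1,-1$ (bang arcs) and $0$ (singular arcs). A switching is a change of the value of $v$ from one of these values to another; a chattering arc is an optimal arc with infinitely many switchings. Controls are identified when they agree a.e. *)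

theory Defs
  imports "HOL-Analysis.Analysis" "HOL-Probability.Essential_Supremum" "HOL-Library.Real_Mod"
begin

section \<open>The geometric problem (P)\<close>

definition test_function :: "real \<Rightarrow> (real \<Rightarrow> real) \<Rightarrow> bool" where
  "test_function T \<phi> \<longleftrightarrow>
     (\<forall>n t. (deriv ^^ n) \<phi> field_differentiable (at t)) \<and>
     compact (closure {t. \<phi> t \<noteq> 0}) \<and> closure {t. \<phi> t \<noteq> 0} \<subseteq> {0<..<T}"

definition weak_derivative ::
    "real \<Rightarrow> (real \<Rightarrow> real \<times> real) \<Rightarrow> (real \<Rightarrow> real \<times> real) \<Rightarrow> bool" where
  "weak_derivative T f g \<longleftrightarrow>
     (\<forall>\<phi>. test_function T \<phi> \<longrightarrow>
        (LINT t|lebesgue_on {0<..<T}. deriv \<phi> t *\<^sub>R f t) =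
        - (LINT t|lebesgue_on {0<..<T}. \<phi> t *\<^sub>R g t))"

definition ess_max :: "real \<Rightarrow> (real \<Rightarrow> real \<times> real) \<Rightarrow> ereal" where
  "ess_max T f = esssup (lebesgue_on {0<..<T}) (\<lambda>t. ereal (norm (f t)))"

text \<open>
  \<open>z\<close> is a curve of class \<open>W\<^sup>2\<^sup>,\<^sup>\<infinity>\<close> on \<open>(0,T)\<close> with first and second weak derivatives \<open>z1\<close> and \<open>z2\<close>.
  Here \<open>z\<close> and \<open>z1\<close> are the representatives that are continuous up to the boundary; they exist
  by the Sobolev embedding and give the boundary conditions of (P) a meaning.  Their boundedness
  follows from continuity on the compact interval.
\<close>
definition W2_infty ::
    "real \<Rightarrow> (real \<Rightarrow> real \<times> real) \<Rightarrow> (real \<Rightarrow> real \<times> real) \<Rightarrow> (real \<Rightarrow> real \<times> real) \<Rightarrow> bool" where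
  "W2_infty T z z1 z2 \<longleftrightarrow>
     continuous_on {0..T} z \<and> continuous_on {0..T} z1 \<and>
     z2 \<in> borel_measurable (lebesgue_on {0<..<T}) \<and> ess_max T z2 < \<infinity> \<and>
     weak_derivative T z z1 \<and> weak_derivative T z1 z2"

definition P_feasible ::
    "real \<times> real \<Rightarrow> real \<times> real \<Rightarrow> real \<times> real \<Rightarrow> real \<times> real \<Rightarrow> real \<Rightarrow>
     (real \<Rightarrow> real \<times> real) \<Rightarrow> (real \<Rightarrow> real \<times> real) \<Rightarrow> (real \<Rightarrow> real \<times> real) \<Rightarrow> bool" where
  "P_feasible z0 zf v0 vf T z z1 z2 \<longleftrightarrow>
     W2_infty T z z1 z2 \<and>
     z 0 = z0 \<and> z T = zf \<and> z1 0 = v0 \<and> z1 T = vf \<and>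
     (AE t in lebesgue_on {0<..<T}. norm (z1 t) = 1)"

definition P_solution ::
    "real \<times> real \<Rightarrow> real \<times> real \<Rightarrow> real \<times> real \<Rightarrow> real \<times> real \<Rightarrow> real \<Rightarrow>
     (real \<Rightarrow> real \<times> real) \<Rightarrow> (real \<Rightarrow> real \<times> real) \<Rightarrow> (real \<Rightarrow> real \<times> real) \<Rightarrow> bool" where
  "P_solution z0 zf v0 vf T z z1 z2 \<longleftrightarrow>
     P_feasible z0 zf v0 vf T z z1 z2 \<and>
     (\<forall>w w1 w2. P_feasible z0 zf v0 vf T w w1 w2 \<longrightarrow> ess_max T z2 \<le> ess_max T w2)"

section \<open>The optimal control problem (OC)\<close>

text \<open>
  \<open>f\<close> is absolutely continuous on \<open>[0,T]\<close> with \<open>f' = g\<close> almost everywhere, in the integral form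
  customary for differential equations with measurable controls.
\<close>
definition ac_derivative :: "real \<Rightarrow> (real \<Rightarrow> real) \<Rightarrow> (real \<Rightarrow> real) \<Rightarrow> bool" where
  "ac_derivative T f g \<longleftrightarrow>
     g absolutely_integrable_on {0..T} \<and>
     (\<forall>t\<in>{0..T}. f t = f 0 + integral {0..t} g)"

definition OC_feasible ::
    "real \<times> real \<Rightarrow> real \<times> real \<Rightarrow> real \<Rightarrow> real \<Rightarrow> real \<Rightarrow>
     (real \<Rightarrow> real) \<Rightarrow> (real \<Rightarrow> real) \<Rightarrow> (real \<Rightarrow> real) \<Rightarrow> (real \<Rightarrow> real) \<Rightarrow> (real \<Rightarrow> real) \<Rightarrow> bool" where
  "OC_feasible z0 zf \<theta>0 \<theta>f T x y \<theta> \<alpha> v \<longleftrightarrow>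
     v \<in> borel_measurable (lebesgue_on {0..T}) \<and>
     (AE t in lebesgue_on {0..T}. \<bar>v t\<bar> \<le> 1) \<and>
     ac_derivative T x (\<lambda>t. cos (\<theta> t)) \<and>
     ac_derivative T y (\<lambda>t. sin (\<theta> t)) \<and>
     ac_derivative T \<theta> (\<lambda>t. \<alpha> t * v t) \<and>
     ac_derivative T \<alpha> (\<lambda>t. 0) \<and> (\<forall>t\<in>{0..T}. \<alpha> t > 0) \<and>
     (x 0, y 0) = z0 \<and> [\<theta> 0 = \<theta>0] (rmod (2 * pi)) \<and>
     (x T, y T) = zf \<and> [\<theta> T = \<theta>f] (rmod (2 * pi))"

definition OC_cost :: "real \<Rightarrow> (real \<Rightarrow> real) \<Rightarrow> real" where
  "OC_cost T \<alpha> = integral {0..T} \<alpha>"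

definition OC_optimal ::
    "real \<times> real \<Rightarrow> real \<times> real \<Rightarrow> real \<Rightarrow> real \<Rightarrow> real \<Rightarrow>
     (real \<Rightarrow> real) \<Rightarrow> (real \<Rightarrow> real) \<Rightarrow> (real \<Rightarrow> real) \<Rightarrow> (real \<Rightarrow> real) \<Rightarrow> (real \<Rightarrow> real) \<Rightarrow> bool" where
  "OC_optimal z0 zf \<theta>0 \<theta>f T x y \<theta> \<alpha> v \<longleftrightarrow>
     OC_feasible z0 zf \<theta>0 \<theta>f T x y \<theta> \<alpha> v \<and>
     (\<forall>x' y' \<theta>' \<alpha>' v'. OC_feasible z0 zf \<theta>0 \<theta>f T x' y' \<theta>' \<alpha>' v' \<longrightarrow>
        OC_cost T \<alpha> \<le> OC_cost T \<alpha>')"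

text \<open>
  \<open>v\<close> is the control of the curve \<open>z\<close> under the passage from (P) to (OC): \<open>z\<close> is the position
  component of an (OC) process whose constant \<open>\<alpha>\<close> is the essential maximum of the
  norm of the second derivative.
\<close>
definition control_of_curve ::
    "real \<times> real \<Rightarrow> real \<times> real \<Rightarrow> real \<Rightarrow> real \<Rightarrow> real \<Rightarrow>
     (real \<Rightarrow> real \<times> real) \<Rightarrow> (real \<Rightarrow> real \<times> real) \<Rightarrow> (real \<Rightarrow> real) \<Rightarrow> bool" where
  "control_of_curve z0 zf \<theta>0 \<theta>f T z z2 v \<longleftrightarrow>
     (\<exists>x y \<theta> \<alpha>. OC_feasible z0 zf \<theta>0 \<theta>f T x y \<theta> \<alpha> v \<and>
        (\<forall>t\<in>{0..T}. z t = (x t, y t) \<and> ereal (\<alpha> t) = ess_max T z2))"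

section \<open>Switchings\<close>

text \<open>
  \<open>[0,T]\<close> splits at finitely many times into bang arcs (value \<open>1\<close> or \<open>-1\<close>) and singular arcs
  (value \<open>0\<close>), up to null sets.  Neighbouring arcs may carry the same value, so \<open>n - 1\<close> is an
  upper bound for the number of switchings.  Any control, in the sense of classes modulo null
  sets, for which this fails has infinitely many switchings, including one whose switching
  times accumulate in a Cantor set.
\<close>
definition finitely_many_switchings :: "real \<Rightarrow> (real \<Rightarrow> real) \<Rightarrow> bool" where
  "finitely_many_switchings T v \<longleftrightarrow>
     (\<exists>(n::nat) (\<tau>::nat \<Rightarrow> real) (c::nat \<Rightarrow> real).
        \<tau> 0 = 0 \<and> \<tau> n = T \<and>
        (\<forall>i<n. \<tau> i < \<tau> (Suc i) \<and> c i \<in> {1, -1, 0} \<and>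
           (AE t in lebesgue_on {\<tau> i<..<\<tau> (Suc i)}. v t = c i)))"

end

theory Submission
  imports Defs
begin

text \<open>
  The idea. Let \<open>u = \<alpha> v\<close> be the curvature of an optimal curve, bounded by the constant \<open>a\<close>.
  If \<open>a\<close> is the least possible bound, then either the three end conditions (final angle and final
  position) cannot be met, to first order, by a control of smaller supremum norm, or variations of
  the control do not move the end point in all three directions.  In both cases a hyperplane in
  three dimensions provides a multiplier: there is a function \<open>\<psi>\<close>, affine along
  the curve, \<open>\<psi> = c + p1 y - p2 x\<close> with \<open>(c, p1, p2) \<noteq> 0\<close>, such that \<open>\<psi> u = a \<bar>\<psi>\<bar>\<close> almost everywhere
  (\<open>maximum_principle\<close>).  Passing from the first order to exact end conditions uses Brouwer's
  fixed point theorem (\<open>competitor_by_brouwer\<close>).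

  If \<open>p1 = p2 = 0\<close>, then \<open>\<psi>\<close> is a nonzero constant and \<open>v\<close> never switches.  Otherwise \<open>\<psi> = 0\<close>
  describes a line; the curve turns one way with full curvature on one side of a line, the other way on the other
  side, and \<open>v\<close> can only switch on the line.  Along the curve the quantity
  \<open>p1 cos \<theta> + p2 sin \<theta> + a \<bar>\<psi>\<bar>\<close> is conserved (\<open>energy_conserved\<close>), so the curve meets the line
  always at the same angle, up to sign.  If it crosses transversally, the zeros of \<open>\<psi>\<close> are isolated.
  If it touches the line at time \<open>x\<close>, then near \<open>x\<close> conservation forces every critical point of \<open>\<psi>\<close> to
  be a zero of \<open>\<psi>\<close>, hence by a maximum argument the zeros near \<open>x\<close> form an interval, on which the
  direction is constant and \<open>v = 0\<close> (\<open>singular_arc\<close>).  In either situation \<open>v\<close> is constant on a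
  one-sided neighbourhood of every time, with value \<open>1\<close>, \<open>-1\<close> or \<open>0\<close>, and compactness of \<open>[0,T]\<close>
  leaves finitely many arcs (\<open>finitely_many_arcs_extremal\<close>).

  A solution of (P) reduces to this: every admissible process of (OC) yields an admissible curve of
  (P) whose second derivative is bounded by its \<open>\<alpha>\<close>, so the process belonging to a solution of (P)
  is optimal for (OC) (\<open>P_solution_imp_OC_optimal\<close>).
\<close>

section \<open>Primitives of bounded measurable functions\<close>

definition bounded_meas :: "real \<Rightarrow> real \<Rightarrow> (real \<Rightarrow> real) \<Rightarrow> bool" where
  "bounded_meas T C g \<longleftrightarrow>
     g \<in> borel_measurable (lebesgue_on {0..T}) \<and> (\<forall>t\<in>{0..T}. \<bar>g t\<bar> \<le> C)"

text \<open>
  Subtracting \<open>f 0\<close> on the left keeps the equation from rewriting \<open>f 0\<close> into itself when it is used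
  by the simplifier.
\<close>
definition primitive :: "real \<Rightarrow> (real \<Rightarrow> real) \<Rightarrow> (real \<Rightarrow> real) \<Rightarrow> bool" where
  "primitive T f g \<longleftrightarrow>
     (\<exists>C. bounded_meas T C g) \<and> (\<forall>t\<in>{0..T}. f t - f 0 = integral {0..t} g)"

lemma bounded_meas_abs_integrable:
  assumes "bounded_meas T C g" and "0 \<le> s" and "t \<le> T"
  shows "g absolutely_integrable_on {s..t}"
proof -
  have "g absolutely_integrable_on {0..T}"
  proof (rule measurable_bounded_by_integrable_imp_absolutely_integrable)
    show "g \<in> borel_measurable (lebesgue_on {0..T})" using assms by (simp add: bounded_meas_def)
    show "(\<lambda>_. C) integrable_on {0..T}" by (simp add: integrable_const_ivl)
    show "norm (g x) \<le> C" if "x \<in> {0..T}" for x using assms that by (simp add: bounded_meas_def)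
  qed simp
  then show ?thesis
    by (rule absolutely_integrable_on_subinterval) (use assms in auto)
qed

lemma bounded_meas_integrable:
  assumes "bounded_meas T C g" and "0 \<le> s" and "t \<le> T"
  shows "g integrable_on {s..t}"
  using bounded_meas_abs_integrable[OF assms] absolutely_integrable_on_def by blast

lemma bounded_meas_integral_le:
  assumes "bounded_meas T C g" and "0 \<le> s" "s \<le> t" "t \<le> T"
  shows "\<bar>integral {s..t} g\<bar> \<le> C * (t - s)"
proof -
  have "norm (integral {s..t} g) \<le> integral {s..t} (\<lambda>_. C)"
    using assms by (intro integral_norm_bound_integral bounded_meas_integrable[OF assms(1)])
      (auto simp: bounded_meas_def integrable_const_ivl)
  then show ?thesis using assms by (simp add: mult.commute)
qed

lemma bounded_meas_mono:
  "bounded_meas T C g \<Longrightarrow> C \<le> D \<Longrightarrow> bounded_meas T D g"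
  unfolding bounded_meas_def by force

lemma bounded_meas_add:
  "bounded_meas T C f \<Longrightarrow> bounded_meas T D g \<Longrightarrow> bounded_meas T (C + D) (\<lambda>t. f t + g t)"
  unfolding bounded_meas_def by (auto intro: order_trans[OF abs_triangle_ineq] add_mono)

lemma bounded_meas_mult:
  assumes "bounded_meas T C f" "bounded_meas T D g"
  shows "bounded_meas T (C * D) (\<lambda>t. f t * g t)"
  unfolding bounded_meas_def
proof (intro conjI ballI)
  show "(\<lambda>t. f t * g t) \<in> borel_measurable (lebesgue_on {0..T})"
    using assms by (auto simp: bounded_meas_def)
  show "\<bar>f t * g t\<bar> \<le> C * D" if "t \<in> {0..T}" for t
    using assms that unfolding bounded_meas_def abs_mult
    by (metis abs_ge_zero mult_mono order_trans)
qed

lemma bounded_meas_cmult: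
  assumes "bounded_meas T D g"
  shows "bounded_meas T (\<bar>c\<bar> * D) (\<lambda>t. c * g t)"
  by (rule bounded_meas_mult[OF _ assms]) (simp add: bounded_meas_def)

lemma bounded_meas_continuous:
  assumes "continuous_on {0..T} f"
  obtains C where "bounded_meas T C f"
proof -
  have "bounded (f ` {0..T})"
    using assms by (intro compact_imp_bounded compact_continuous_image) auto
  then obtain C where "\<forall>t\<in>{0..T}. \<bar>f t\<bar> \<le> C"
    by (auto simp: bounded_iff)
  with assms have "bounded_meas T C f"
    unfolding bounded_meas_def by (auto intro: continuous_imp_measurable_on_sets_lebesgue)
  then show thesis by (rule that)
qed

lemma primitive_diff:
  assumes "primitive T f g" and "0 \<le> s" "s \<le> t" "t \<le> T"
  shows "f t - f s = integral {s..t} g"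
proof -
  obtain C where C: "bounded_meas T C g" using assms by (auto simp: primitive_def)
  have "integral {0..s} g + integral {s..t} g = integral {0..t} g"
    by (rule Henstock_Kurzweil_Integration.integral_combine)
      (use assms bounded_meas_integrable[OF C] in auto)
  moreover have "f t - f 0 = integral {0..t} g" "f s - f 0 = integral {0..s} g"
    using assms by (auto simp: primitive_def)
  ultimately show ?thesis by simp
qed

lemma primitive_lipschitz:
  assumes "primitive T f g" "bounded_meas T C g" "s \<in> {0..T}" "t \<in> {0..T}"
  shows "\<bar>f t - f s\<bar> \<le> C * \<bar>t - s\<bar>"
  using primitive_diff[OF assms(1), of s t] primitive_diff[OF assms(1), of t s]
    bounded_meas_integral_le[OF assms(2), of s t] bounded_meas_integral_le[OF assms(2), of t s]
    assms(3,4) by (cases "s \<le> t") auto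

lemma primitive_continuous:
  assumes "primitive T f g"
  shows "continuous_on {0..T} f"
proof -
  obtain C where C: "bounded_meas T C g" using assms by (auto simp: primitive_def)
  have "continuous_on {0..T} (\<lambda>t. f 0 + integral {0..t} g)"
    by (intro continuous_intros indefinite_integral_continuous_1 bounded_meas_integrable[OF C]) auto
  moreover have "f 0 + integral {0..t} g = f t" if "t \<in> {0..T}" for t
  proof -
    have "f t - f 0 = integral {0..t} g" using assms that by (auto simp: primitive_def)
    then show ?thesis by linarith
  qed
  ultimately show ?thesis by (simp only: cong: continuous_on_cong)
qed

text \<open>
  This replaces differentiation almost everywhere in the chain and product rules below: both
  sides of such a rule have increments that agree up to the square of the time step.
\<close>
lemma constant_if_quadratic_increments:
  fixes G :: "real \<Rightarrow> real"
  assumes quad: "\<And>s t. 0 \<le> s \<Longrightarrow> s \<le> t \<Longrightarrow> t \<le> T \<Longrightarrow> \<bar>G t - G s\<bar> \<le> K * (t - s)\<^sup>2"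
    and "t \<in> {0..T}"
  shows "G t = G 0"
proof (rule has_derivative_zero_unique[where s = "{0..T}" and f = G])
  have K: "\<bar>G t - G s\<bar> \<le> \<bar>K\<bar> * (t - s)\<^sup>2" if "s \<in> {0..T}" "t \<in> {0..T}" for s t
  proof -
    have "\<bar>G t - G s\<bar> \<le> K * (t - s)\<^sup>2"
      using quad[of s t] quad[of t s] that abs_minus_commute[of "G t" "G s"] power2_commute[of t s]
      by (cases "s \<le> t") auto
    also have "\<dots> \<le> \<bar>K\<bar> * (t - s)\<^sup>2" by (intro mult_right_mono) auto
    finally show ?thesis .
  qed
  show "(G has_derivative (\<lambda>h. 0)) (at s within {0..T})" if s: "s \<in> {0..T}" for s
    unfolding has_derivative_within_alt2
  proof (intro conjI allI impI)
    fix e :: real assume "e > 0"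
    have "\<bar>G y - G s\<bar> \<le> e * \<bar>y - s\<bar>" if "y \<in> {0..T}" "\<bar>y - s\<bar> < e / (\<bar>K\<bar> + 1)" for y
    proof -
      have "\<bar>K\<bar> * \<bar>y - s\<bar> \<le> (\<bar>K\<bar> + 1) * \<bar>y - s\<bar>" by (intro mult_right_mono) auto
      also have "\<dots> \<le> e" using that(2) by (simp add: field_simps)
      finally have "\<bar>K\<bar> * \<bar>y - s\<bar> * \<bar>y - s\<bar> \<le> e * \<bar>y - s\<bar>" by (intro mult_right_mono) auto
      then show ?thesis using K[OF s that(1)] by (simp add: power2_eq_square mult.assoc)
    qed
    then show "\<forall>\<^sub>F y in at s within {0..T}. norm (G y - G s - 0) \<le> e * norm (y - s)"
      unfolding eventually_at using \<open>e > 0\<close>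
      by (intro exI[of _ "e / (\<bar>K\<bar> + 1)"]) (auto simp: dist_real_def)
  qed simp
qed (use assms in auto)

lemma taylor_quadratic:
  fixes F F' :: "real \<Rightarrow> real"
  assumes "\<And>x. (F has_real_derivative F' x) (at x)"
    and lip: "\<And>x y. \<bar>F' x - F' y\<bar> \<le> K * \<bar>x - y\<bar>"
  shows "\<bar>F b - F a - F' a * (b - a)\<bar> \<le> K * (b - a)\<^sup>2"
proof -
  have "\<exists>z. \<bar>z - a\<bar> \<le> \<bar>b - a\<bar> \<and> F b - F a = F' z * (b - a)"
  proof (cases a b rule: linorder_cases)
    case less
    from MVT2[OF less, of F F'] assms(1) obtain z where "a < z" "z < b" "F b - F a = (b - a) * F' z"
      by auto
    then show ?thesis by (intro exI[of _ z]) (auto simp: mult.commute)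
  next
    case greater
    from MVT2[OF greater, of F F'] assms(1) obtain z
      where "b < z" "z < a" "F a - F b = (a - b) * F' z" by auto
    then show ?thesis by (intro exI[of _ z]) (auto simp: algebra_simps)
  qed auto
  then obtain z where z: "\<bar>z - a\<bar> \<le> \<bar>b - a\<bar>" "F b - F a = F' z * (b - a)" by auto
  have K: "0 \<le> K" using lip[of 0 1] by auto
  have "\<bar>F b - F a - F' a * (b - a)\<bar> = \<bar>F' z - F' a\<bar> * \<bar>b - a\<bar>"
    unfolding z(2) by (metis abs_mult left_diff_distrib)
  also have "\<dots> \<le> K * \<bar>z - a\<bar> * \<bar>b - a\<bar>" by (intro mult_right_mono lip) auto
  also have "\<dots> \<le> K * \<bar>b - a\<bar> * \<bar>b - a\<bar>" using z K by (intro mult_right_mono mult_left_mono) auto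
  finally show ?thesis by (simp add: power2_eq_square)
qed

text \<open>
  Chain rule.  Over a step from \<open>s\<close> to \<open>t\<close> both the Taylor remainder of \<open>F\<close> and the replacement of
  \<open>F' (\<theta> r)\<close> by \<open>F' (\<theta> s)\<close> under the integral cost \<open>O((t - s)\<^sup>2)\<close>, since \<open>\<theta>\<close> and \<open>F'\<close> are Lipschitz.
\<close>
lemma primitive_compose:
  assumes \<theta>: "primitive T \<theta> u"
    and F: "\<And>x. (F has_real_derivative F' x) (at x)"
    and lip: "\<And>x y. \<bar>F' x - F' y\<bar> \<le> K * \<bar>x - y\<bar>"
  shows "primitive T (\<lambda>t. F (\<theta> t)) (\<lambda>t. F' (\<theta> t) * u t)"
proof -
  obtain C where C: "bounded_meas T C u" using \<theta> by (auto simp: primitive_def)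
  have K: "0 \<le> K" using lip[of 0 1] by auto
  have "continuous_on UNIV F'"
    unfolding continuous_on_iff
  proof (intro ballI allI impI)
    fix x e :: real assume "e > 0"
    have "dist (F' y) (F' x) < e" if "dist y x < e / (K + 1)" for y
    proof -
      have "\<bar>F' y - F' x\<bar> \<le> K * \<bar>y - x\<bar>" by (rule lip)
      also have "\<dots> \<le> (K + 1) * \<bar>y - x\<bar>" by (intro mult_right_mono) auto
      also have "\<dots> < e" using that K by (simp add: dist_real_def field_simps)
      finally show ?thesis by (simp add: dist_real_def)
    qed
    then show "\<exists>d>0. \<forall>y\<in>UNIV. dist y x < d \<longrightarrow> dist (F' y) (F' x) < e"
      using \<open>e > 0\<close> K by (intro exI[of _ "e / (K + 1)"]) auto
  qed
  then have "continuous_on {0..T} (\<lambda>t. F' (\<theta> t))"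
    by (intro continuous_on_compose2[OF _ primitive_continuous[OF \<theta>]]) auto
  then obtain D where D: "bounded_meas T D (\<lambda>t. F' (\<theta> t))" by (rule bounded_meas_continuous)
  have Fu: "bounded_meas T (D * C) (\<lambda>t. F' (\<theta> t) * u t)" by (rule bounded_meas_mult[OF D C])
  define G where "G t = F (\<theta> t) - integral {0..t} (\<lambda>t. F' (\<theta> t) * u t)" for t
  have G0: "G t = G 0" if "t \<in> {0..T}" for t
  proof (rule constant_if_quadratic_increments[OF _ that])
    fix s t :: real assume st: "0 \<le> s" "s \<le> t" "t \<le> T"
    have C0: "0 \<le> C" using C st unfolding bounded_meas_def by force
    have dth: "\<theta> t - \<theta> s = integral {s..t} u" by (rule primitive_diff[OF \<theta> st])
    have i1: "(\<lambda>t. F' (\<theta> t) * u t) integrable_on {s..t}" and i2: "u integrable_on {s..t}"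
      using bounded_meas_integrable[OF Fu] bounded_meas_integrable[OF C] st by auto
    have "integral {0..s} (\<lambda>t. F' (\<theta> t) * u t) + integral {s..t} (\<lambda>t. F' (\<theta> t) * u t)
        = integral {0..t} (\<lambda>t. F' (\<theta> t) * u t)"
      by (rule Henstock_Kurzweil_Integration.integral_combine)
        (use st bounded_meas_integrable[OF Fu] in auto)
    then have "G t - G s = (F (\<theta> t) - F (\<theta> s)) - integral {s..t} (\<lambda>t. F' (\<theta> t) * u t)"
      by (simp add: G_def)
    also have "\<dots> = (F (\<theta> t) - F (\<theta> s) - F' (\<theta> s) * (\<theta> t - \<theta> s))
        - integral {s..t} (\<lambda>r. F' (\<theta> r) * u r - F' (\<theta> s) * u r)"
      using integral_diff[OF i1 integrable_on_mult_right[OF i2, of "F' (\<theta> s)"]] by (simp add: dth)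
    finally have eq: "G t - G s = (F (\<theta> t) - F (\<theta> s) - F' (\<theta> s) * (\<theta> t - \<theta> s))
        - integral {s..t} (\<lambda>r. F' (\<theta> r) * u r - F' (\<theta> s) * u r)" .
    have "\<bar>F (\<theta> t) - F (\<theta> s) - F' (\<theta> s) * (\<theta> t - \<theta> s)\<bar> \<le> K * (\<theta> t - \<theta> s)\<^sup>2"
      by (rule taylor_quadratic[OF F lip])
    also have "\<dots> \<le> K * (C * (t - s))\<^sup>2"
    proof (intro mult_left_mono K)
      have "\<bar>\<theta> t - \<theta> s\<bar> \<le> C * (t - s)"
        using primitive_lipschitz[OF \<theta> C, of s t] st by auto
      then show "(\<theta> t - \<theta> s)\<^sup>2 \<le> (C * (t - s))\<^sup>2"
        by (metis abs_ge_zero power2_abs power_mono)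
    qed
    finally have b1: "\<bar>F (\<theta> t) - F (\<theta> s) - F' (\<theta> s) * (\<theta> t - \<theta> s)\<bar> \<le> K * (C * (t - s))\<^sup>2" .
    have "norm (integral {s..t} (\<lambda>r. F' (\<theta> r) * u r - F' (\<theta> s) * u r))
        \<le> integral {s..t} (\<lambda>_. K * (C * (t - s)) * C)"
    proof (rule integral_norm_bound_integral)
      show "norm (F' (\<theta> r) * u r - F' (\<theta> s) * u r) \<le> K * (C * (t - s)) * C"
        if r: "r \<in> {s..t}" for r
      proof -
        have "\<bar>F' (\<theta> r) - F' (\<theta> s)\<bar> \<le> K * \<bar>\<theta> r - \<theta> s\<bar>" by (rule lip)
        also have "\<dots> \<le> K * (C * (t - s))"
        proof (intro mult_left_mono K)
          have "\<bar>\<theta> r - \<theta> s\<bar> \<le> C * \<bar>r - s\<bar>" using primitive_lipschitz[OF \<theta> C, of s r] st r by auto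
          also have "\<dots> \<le> C * (t - s)" using C0 r by (intro mult_left_mono) auto
          finally show "\<bar>\<theta> r - \<theta> s\<bar> \<le> C * (t - s)" .
        qed
        finally have "\<bar>F' (\<theta> r) - F' (\<theta> s)\<bar> \<le> K * (C * (t - s))" .
        moreover have "\<bar>u r\<bar> \<le> C" using C r st by (auto simp: bounded_meas_def)
        ultimately have "\<bar>F' (\<theta> r) - F' (\<theta> s)\<bar> * \<bar>u r\<bar> \<le> K * (C * (t - s)) * C"
          by (intro mult_mono) (auto intro: order_trans[OF abs_ge_zero])
        then show ?thesis by (simp add: abs_mult[symmetric] left_diff_distrib)
      qed
    qed (use i1 i2 in \<open>auto intro!: integrable_diff integrable_on_mult_right\<close>)
    then have b2: "\<bar>integral {s..t} (\<lambda>r. F' (\<theta> r) * u r - F' (\<theta> s) * u r)\<bar> \<le> K * (C * (t - s)) * C * (t - s)"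
      using st by (simp add: mult.assoc mult.left_commute mult.commute)
    show "\<bar>G t - G s\<bar> \<le> (2 * K * C\<^sup>2) * (t - s)\<^sup>2"
      using b1 b2 unfolding eq by (simp add: power2_eq_square algebra_simps)
  qed
  have "F (\<theta> t) - F (\<theta> 0) = integral {0..t} (\<lambda>t. F' (\<theta> t) * u t)" if "t \<in> {0..T}" for t
    using G0[OF that] by (simp add: G_def)
  then show ?thesis using Fu unfolding primitive_def by blast
qed

lemma primitive_add:
  assumes "primitive T f g" "primitive T F G"
  shows "primitive T (\<lambda>t. f t + F t) (\<lambda>t. g t + G t)"
proof -
  obtain C D where CD: "bounded_meas T C g" "bounded_meas T D G"
    using assms by (auto simp: primitive_def)
  have "(f t + F t) - (f 0 + F 0) = integral {0..t} (\<lambda>t. g t + G t)" if "t \<in> {0..T}" for t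
  proof -
    have "f t - f 0 = integral {0..t} g" "F t - F 0 = integral {0..t} G"
      using assms that by (auto simp: primitive_def)
    moreover have "integral {0..t} (\<lambda>t. g t + G t) = integral {0..t} g + integral {0..t} G"
      using that by (intro integral_add bounded_meas_integrable[OF CD(1)] bounded_meas_integrable[OF CD(2)]) auto
    ultimately show ?thesis by linarith
  qed
  with bounded_meas_add[OF CD] show ?thesis by (auto simp: primitive_def)
qed

lemma primitive_cmult:
  assumes "primitive T f g"
  shows "primitive T (\<lambda>t. c * f t) (\<lambda>t. c * g t)"
proof -
  obtain C where C: "bounded_meas T C g"
    using assms by (auto simp: primitive_def)
  have "c * f t - c * f 0 = integral {0..t} (\<lambda>t. c * g t)" if "t \<in> {0..T}" for t
    using assms that by (simp add: primitive_def flip: right_diff_distrib)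
  with bounded_meas_cmult[OF C] show ?thesis by (auto simp: primitive_def)
qed

lemma primitive_mult:
  assumes "primitive T f g" "primitive T F G"
  shows "primitive T (\<lambda>t. f t * F t) (\<lambda>t. g t * F t + f t * G t)"
proof -
  have sq: "primitive T (\<lambda>t. (h t)\<^sup>2) (\<lambda>t. 2 * h t * k t)" if "primitive T h k" for h k
  proof (rule primitive_compose[OF that, where F = "\<lambda>x. x\<^sup>2" and F' = "\<lambda>x. 2 * x" and K = 2])
    show "((\<lambda>x. x\<^sup>2) has_real_derivative 2 * x) (at x)" for x :: real
      by (auto intro!: derivative_eq_intros)
    show "\<bar>2 * x - 2 * y\<bar> \<le> 2 * \<bar>x - y\<bar>" for x y :: real by (simp add: abs_if)
  qed
  \<comment> \<open>polarization reduces products to squares\<close>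
  have "primitive T (\<lambda>t. 1/4 * (f t + F t)\<^sup>2 + (-1/4) * (f t + (-1) * F t)\<^sup>2)
    (\<lambda>t. 1/4 * (2 * (f t + F t) * (g t + G t)) + (-1/4) * (2 * (f t + (-1) * F t) * (g t + (-1) * G t)))"
    by (intro primitive_add primitive_cmult sq assms)
  moreover have "(\<lambda>t. 1/4 * (f t + F t)\<^sup>2 + (-1/4) * (f t + (-1) * F t)\<^sup>2) = (\<lambda>t. f t * F t)"
    by (intro ext) (simp add: power2_eq_square field_simps)
  moreover have "(\<lambda>t. 1/4 * (2 * (f t + F t) * (g t + G t)) + (-1/4) * (2 * (f t + (-1) * F t) * (g t + (-1) * G t)))
      = (\<lambda>t. g t * F t + f t * G t)"
    by (intro ext) (simp add: field_simps)
  ultimately show ?thesis by simp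
qed

lemma sin_cos_lipschitz:
  "\<bar>sin x - sin y\<bar> \<le> 1 * \<bar>x - y\<bar>" "\<bar>cos x - cos y\<bar> \<le> 1 * \<bar>x - y\<bar>" for x y :: real
proof -
  have "norm (sin x - sin y) \<le> 1 * norm (x - y)"
    by (rule field_differentiable_bound[of UNIV sin cos]) (auto intro!: derivative_eq_intros)
  then show "\<bar>sin x - sin y\<bar> \<le> 1 * \<bar>x - y\<bar>" by simp
  have "norm (cos x - cos y) \<le> 1 * norm (x - y)"
    by (rule field_differentiable_bound[of UNIV cos "\<lambda>x. - sin x"]) (auto intro!: derivative_eq_intros)
  then show "\<bar>cos x - cos y\<bar> \<le> 1 * \<bar>x - y\<bar>" by simp
qed

lemma primitive_cos:
  assumes "primitive T \<theta> u"
  shows "primitive T (\<lambda>t. cos (\<theta> t)) (\<lambda>t. - sin (\<theta> t) * u t)"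
proof (rule primitive_compose[OF assms, where K = 1])
  show "(cos has_real_derivative - sin x) (at x)" for x :: real
    by (auto intro!: derivative_eq_intros)
  show "\<bar>- sin x - - sin y\<bar> \<le> 1 * \<bar>x - y\<bar>" for x y :: real
    using sin_cos_lipschitz(1)[of x y] by linarith
qed

lemma primitive_sin:
  assumes "primitive T \<theta> u"
  shows "primitive T (\<lambda>t. sin (\<theta> t)) (\<lambda>t. cos (\<theta> t) * u t)"
  by (rule primitive_compose[OF assms, where K = 1])
    (use sin_cos_lipschitz(2) in \<open>auto intro!: derivative_eq_intros\<close>)

section \<open>From (OC) to (P)\<close>

lemma primitive_C1:
  fixes f f' :: "real \<Rightarrow> real"
  assumes der: "\<And>t. (f has_real_derivative f' t) (at t)" and "continuous_on UNIV f'"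
  shows "primitive T f f'"
proof -
  have "continuous_on {0..T} f'" using assms(2) continuous_on_subset by blast
  then obtain C where "bounded_meas T C f'" by (rule bounded_meas_continuous)
  moreover have "f t - f 0 = integral {0..t} f'" if "t \<in> {0..T}" for t
  proof -
    have "(f' has_integral (f t - f 0)) {0..t}"
      using that der
      by (intro fundamental_theorem_of_calculus)
        (auto simp flip: has_real_derivative_iff_has_vector_derivative intro: has_field_derivative_at_within)
    then show ?thesis by (simp add: integral_unique)
  qed
  ultimately show ?thesis by (auto simp: primitive_def)
qed

lemma AE_lebesgue_on_iff:
  "S \<in> sets lebesgue \<Longrightarrow> (AE t in lebesgue_on S. P t) \<longleftrightarrow> (AE t in lebesgue. t \<in> S \<longrightarrow> P t)"
  by (simp add: AE_restrict_space_iff)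

lemma integral_cong_AE_lebesgue:
  fixes f g :: "real \<Rightarrow> real"
  assumes "AE t in lebesgue. t \<in> S \<longrightarrow> f t = g t"
  shows "integral S f = integral S g"
proof -
  obtain N where "negligible N" "{t. \<not> (t \<in> S \<longrightarrow> f t = g t)} \<subseteq> N"
    using assms by (auto simp: eventually_ae_filter_negligible)
  then show ?thesis by (intro integral_spike[of N]) auto
qed

lemma bounded_meas_has_bochner_integral:
  assumes "bounded_meas T C h"
  shows "has_bochner_integral (lebesgue_on {0<..<T}) h (integral {0..T} h)"
proof -
  have "h absolutely_integrable_on {0<..<T}"
    by (rule set_integrable_subset[OF bounded_meas_abs_integrable[OF assms, of 0 T]]) auto
  then have "integrable (lebesgue_on {0<..<T}) h"
    by (simp add: integrable_restrict_space set_integrable_def)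
  moreover from this have "integral\<^sup>L (lebesgue_on {0<..<T}) h = integral {0<..<T} h"
    by (rule lebesgue_integral_eq_integral) auto
  moreover have "integral {0<..<T} h = integral {0..T} h"
    using integral_open_interval_real[of 0 T h] by simp
  ultimately show ?thesis by (simp add: has_bochner_integral_iff)
qed

lemma lebesgue_integral_Pair:
  assumes "bounded_meas T C h" "bounded_meas T D k"
  shows "(LINT t|lebesgue_on {0<..<T}. (h t, k t)) = (integral {0..T} h, integral {0..T} k)"
proof -
  have "has_bochner_integral (lebesgue_on {0<..<T})
      (\<lambda>t. h t *\<^sub>R (1::real, 0::real) + k t *\<^sub>R (0::real, 1::real))
      (integral {0..T} h *\<^sub>R (1, 0) + integral {0..T} k *\<^sub>R (0, 1))"
    by (intro has_bochner_integral_add has_bochner_integral_scaleR_left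
        bounded_meas_has_bochner_integral[OF assms(1)] bounded_meas_has_bochner_integral[OF assms(2)])
  then show ?thesis by (simp add: has_bochner_integral_iff)
qed

text \<open>
  Integration by parts against a test function is the product rule, as the test function vanishes
  at both ends.
\<close>
lemma primitive_weak_derivative:
  assumes "primitive T f1 g1" "primitive T f2 g2" and T: "0 \<le> T"
  shows "weak_derivative T (\<lambda>t. (f1 t, f2 t)) (\<lambda>t. (g1 t, g2 t))"
  unfolding weak_derivative_def
proof (intro allI impI)
  fix \<phi> assume \<phi>: "test_function T \<phi>"
  have d: "(deriv ^^ n) \<phi> field_differentiable (at t)" for n t
    using \<phi> by (auto simp: test_function_def)
  have d0: "(\<phi> has_real_derivative deriv \<phi> t) (at t)" for t
    using d[of 0 t] by (simp add: field_differentiable_derivI)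
  have d1: "continuous_on UNIV (deriv \<phi>)"
    using d[of 1] by (intro continuous_at_imp_continuous_on) (auto intro: field_differentiable_imp_continuous_at)
  have p\<phi>: "primitive T \<phi> (deriv \<phi>)" by (rule primitive_C1[OF d0 d1])
  have supp: "\<phi> t = 0" if "t \<notin> {0<..<T}" for t
    using \<phi> closure_subset[of "{t. \<phi> t \<noteq> 0}"] that unfolding test_function_def by blast
  have cont\<phi>: "continuous_on {0..T} \<phi>" "continuous_on {0..T} (deriv \<phi>)"
    using primitive_continuous[OF p\<phi>] d1 continuous_on_subset by blast+
  have parts: "integral {0..T} (\<lambda>t. deriv \<phi> t * f t) = - integral {0..T} (\<lambda>t. \<phi> t * g t)
      \<and> (\<exists>C. bounded_meas T C (\<lambda>t. deriv \<phi> t * f t)) \<and> (\<exists>C. bounded_meas T C (\<lambda>t. \<phi> t * g t))"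
    if fg: "primitive T f g" for f g
  proof -
    obtain C1 C2 C3 C4 where C: "bounded_meas T C1 \<phi>" "bounded_meas T C2 (deriv \<phi>)"
      "bounded_meas T C3 f" "bounded_meas T C4 g"
      using bounded_meas_continuous[OF cont\<phi>(1)] bounded_meas_continuous[OF cont\<phi>(2)]
        bounded_meas_continuous[OF primitive_continuous[OF fg]] fg by (metis primitive_def)
    have 1: "bounded_meas T (C2 * C3) (\<lambda>t. deriv \<phi> t * f t)" "bounded_meas T (C1 * C4) (\<lambda>t. \<phi> t * g t)"
      by (intro bounded_meas_mult C)+
    have "\<phi> T * f T - \<phi> 0 * f 0 = integral {0..T} (\<lambda>t. deriv \<phi> t * f t + \<phi> t * g t)"
      using primitive_diff[OF primitive_mult[OF p\<phi> fg], of 0 T] T by simp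
    also have "\<dots> = integral {0..T} (\<lambda>t. deriv \<phi> t * f t) + integral {0..T} (\<lambda>t. \<phi> t * g t)"
      using 1 T by (intro integral_add) (auto intro: bounded_meas_integrable)
    finally show ?thesis using 1 supp[of 0] supp[of T] by auto
  qed
  obtain C1 C2 C3 C4 where "bounded_meas T C1 (\<lambda>t. deriv \<phi> t * f1 t)" "bounded_meas T C2 (\<lambda>t. \<phi> t * g1 t)"
      "bounded_meas T C3 (\<lambda>t. deriv \<phi> t * f2 t)" "bounded_meas T C4 (\<lambda>t. \<phi> t * g2 t)"
    using parts[OF assms(1)] parts[OF assms(2)] by blast
  then show "(LINT t|lebesgue_on {0<..<T}. deriv \<phi> t *\<^sub>R (f1 t, f2 t)) =
        - (LINT t|lebesgue_on {0<..<T}. \<phi> t *\<^sub>R (g1 t, g2 t))"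
    using parts[OF assms(1)] parts[OF assms(2)] by (simp add: lebesgue_integral_Pair)
qed

text \<open>
  Planar unit-speed curve with direction angle \<open>\<theta>\<close> and signed curvature \<open>u\<close> bounded by \<open>a\<close>.  Its
  curvature plays the role of \<open>\<alpha> v\<close> in (OC) and is bounded everywhere, not only almost everywhere.
\<close>
definition curvature_curve :: "real \<Rightarrow> real \<Rightarrow> (real \<Rightarrow> real) \<Rightarrow> (real \<Rightarrow> real) \<Rightarrow> (real \<Rightarrow> real) \<Rightarrow>
    (real \<Rightarrow> real) \<Rightarrow> bool" where
  "curvature_curve T a u x y \<theta> \<longleftrightarrow>
     bounded_meas T a u \<and> primitive T \<theta> u \<and>
     primitive T x (\<lambda>t. cos (\<theta> t)) \<and> primitive T y (\<lambda>t. sin (\<theta> t))"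

lemma ac_derivative_imp_primitive:
  assumes "ac_derivative T f g" "bounded_meas T C h" "AE t in lebesgue. t \<in> {0..T} \<longrightarrow> g t = h t"
  shows "primitive T f h"
  unfolding primitive_def
proof (intro conjI ballI exI)
  show "bounded_meas T C h" by fact
  fix t assume t: "t \<in> {0..T}"
  have "f t = f 0 + integral {0..t} g" using assms(1) t unfolding ac_derivative_def by blast
  moreover have "integral {0..t} g = integral {0..t} h"
    by (rule integral_cong_AE_lebesgue) (use assms(3) t in \<open>auto elim!: eventually_mono\<close>)
  ultimately show "f t - f 0 = integral {0..t} h" by linarith
qed

lemma primitive_imp_ac_derivative:
  assumes "primitive T f g"
  shows "ac_derivative T f g"
proof -
  obtain C where "bounded_meas T C g" using assms by (auto simp: primitive_def)
  then have "g absolutely_integrable_on {0..T}" by (rule bounded_meas_abs_integrable) auto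
  moreover have "f t = f 0 + integral {0..t} g" if "t \<in> {0..T}" for t
  proof -
    have "f t - f 0 = integral {0..t} g" using assms that by (auto simp: primitive_def)
    then show ?thesis by linarith
  qed
  ultimately show ?thesis unfolding ac_derivative_def by blast
qed

text \<open>
  Truncating \<open>v\<close> to \<open>[-1,1]\<close> changes it on a null set only and leaves the trajectory unchanged.
\<close>
lemma OC_feasible_imp_curve:
  assumes OC: "OC_feasible z0 zf \<theta>0 \<theta>f T x y \<theta> \<alpha> v" and T: "0 \<le> T"
  obtains a u where "a > 0" "\<And>t. t \<in> {0..T} \<Longrightarrow> \<alpha> t = a" "curvature_curve T a u x y \<theta>"
    "AE t in lebesgue. t \<in> {0..T} \<longrightarrow> u t = a * v t"
proof -
  define a where "a = \<alpha> 0"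
  have \<alpha>: "\<alpha> t = a" if "t \<in> {0..T}" for t
  proof -
    have "\<alpha> t = \<alpha> 0 + integral {0..t} (\<lambda>t. 0)"
      using OC that unfolding OC_feasible_def ac_derivative_def by blast
    then show ?thesis by (simp add: a_def)
  qed
  have a: "a > 0" using OC T by (auto simp: OC_feasible_def a_def)
  define u where "u t = a * max (- 1) (min 1 (v t))" for t
  have vm: "v \<in> borel_measurable (lebesgue_on {0..T})" using OC by (auto simp: OC_feasible_def)
  have u: "bounded_meas T a u"
    unfolding bounded_meas_def
  proof (intro conjI ballI)
    show "u \<in> borel_measurable (lebesgue_on {0..T})"
      unfolding u_def using vm by measurable
    show "\<bar>u t\<bar> \<le> a" for t
    proof -
      have "\<bar>max (- 1) (min 1 (v t))\<bar> \<le> 1" by linarith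
      then show ?thesis unfolding u_def using a by (simp add: abs_mult mult_left_le)
    qed
  qed
  have "AE t in lebesgue. t \<in> {0..T} \<longrightarrow> \<bar>v t\<bar> \<le> 1"
    using OC by (simp add: OC_feasible_def AE_lebesgue_on_iff)
  then have uv: "AE t in lebesgue. t \<in> {0..T} \<longrightarrow> u t = a * v t"
    by (rule eventually_mono) (auto simp: u_def)
  then have uv': "AE t in lebesgue. t \<in> {0..T} \<longrightarrow> \<alpha> t * v t = u t"
    by (rule eventually_mono) (auto simp: \<alpha>)
  have \<theta>: "primitive T \<theta> u"
    using OC by (intro ac_derivative_imp_primitive[OF _ u uv']) (auto simp: OC_feasible_def)
  have cont: "continuous_on {0..T} (\<lambda>t. cos (\<theta> t))" "continuous_on {0..T} (\<lambda>t. sin (\<theta> t))"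
    by (intro continuous_intros primitive_continuous[OF \<theta>])+
  obtain C D where CD: "bounded_meas T C (\<lambda>t. cos (\<theta> t))" "bounded_meas T D (\<lambda>t. sin (\<theta> t))"
    using bounded_meas_continuous[OF cont(1)] bounded_meas_continuous[OF cont(2)] by metis
  have "primitive T x (\<lambda>t. cos (\<theta> t))" "primitive T y (\<lambda>t. sin (\<theta> t))"
    using OC by (auto intro: ac_derivative_imp_primitive[OF _ CD(1)] ac_derivative_imp_primitive[OF _ CD(2)] simp: OC_feasible_def)
  with u \<theta> have "curvature_curve T a u x y \<theta>" by (simp add: curvature_curve_def)
  from that[OF a \<alpha> this uv] show thesis .
qed

lemma curve_imp_OC_feasible:
  assumes c: "curvature_curve T a u x y \<theta>" and a: "a > 0"
    and ends: "(x 0, y 0) = z0" "[\<theta> 0 = \<theta>0] (rmod (2 * pi))" "(x T, y T) = zf" "[\<theta> T = \<theta>f] (rmod (2 * pi))"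
  shows "OC_feasible z0 zf \<theta>0 \<theta>f T x y \<theta> (\<lambda>_. a) (\<lambda>t. u t / a)"
proof -
  have u: "bounded_meas T a u" and p: "primitive T \<theta> u" "primitive T x (\<lambda>t. cos (\<theta> t))" "primitive T y (\<lambda>t. sin (\<theta> t))"
    using c by (simp_all add: curvature_curve_def)
  have "(\<lambda>t. u t / a) \<in> borel_measurable (lebesgue_on {0..T})"
    using u by (intro borel_measurable_divide) (auto simp: bounded_meas_def)
  moreover have "AE t in lebesgue_on {0..T}. \<bar>u t / a\<bar> \<le> 1"
    using u a by (intro AE_I2) (simp add: bounded_meas_def)
  moreover have "ac_derivative T (\<lambda>_. a) (\<lambda>t. 0)"
    by (simp add: ac_derivative_def)
  moreover have "ac_derivative T \<theta> (\<lambda>t. a * (u t / a))"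
    using primitive_imp_ac_derivative[OF p(1)] a by simp
  moreover note p(2,3)[THEN primitive_imp_ac_derivative]
  ultimately show ?thesis
    unfolding OC_feasible_def using a ends by blast
qed

lemma OC_cost_constant:
  assumes "\<And>t. t \<in> {0..T} \<Longrightarrow> \<alpha> t = a" "0 \<le> T"
  shows "OC_cost T \<alpha> = a * T"
proof -
  have "integral {0..T} \<alpha> = integral {0..T} (\<lambda>_. a)"
    using assms by (intro integral_cong) auto
  then show ?thesis using assms by (simp add: OC_cost_def)
qed

lemma curve_P_feasible:
  assumes c: "curvature_curve T a u x y \<theta>" and T: "0 < T"
    and ends: "(x 0, y 0) = z0" "[\<theta> 0 = \<theta>0] (rmod (2 * pi))" "(x T, y T) = zf" "[\<theta> T = \<theta>f] (rmod (2 * pi))"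
  defines "z2 \<equiv> \<lambda>t. (- sin (\<theta> t) * u t, cos (\<theta> t) * u t)"
  shows "P_feasible z0 zf (cos \<theta>0, sin \<theta>0) (cos \<theta>f, sin \<theta>f) T (\<lambda>t. (x t, y t)) (\<lambda>t. (cos (\<theta> t), sin (\<theta> t))) z2"
    and "ess_max T z2 \<le> ereal a"
proof -
  have u: "bounded_meas T a u" and p: "primitive T \<theta> u" "primitive T x (\<lambda>t. cos (\<theta> t))" "primitive T y (\<lambda>t. sin (\<theta> t))"
    using c by (auto simp: curvature_curve_def)
  have n2: "norm (z2 t) = \<bar>u t\<bar>" for t
  proof -
    have "(- sin (\<theta> t) * u t)\<^sup>2 + (cos (\<theta> t) * u t)\<^sup>2 = ((sin (\<theta> t))\<^sup>2 + (cos (\<theta> t))\<^sup>2) * (u t)\<^sup>2"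
      unfolding distrib_right power_mult_distrib by simp
    then show ?thesis unfolding z2_def norm_Pair by simp
  qed
  have um: "u \<in> borel_measurable (lebesgue_on {0<..<T})"
    using u unfolding bounded_meas_def by (auto intro: measurable_restrict_mono)
  have meas: "z2 \<in> borel_measurable (lebesgue_on {0<..<T})"
  proof -
    have "continuous_on {0<..<T} \<theta>"
      using primitive_continuous[OF p(1)] by (rule continuous_on_subset) auto
    then have [measurable]: "\<theta> \<in> borel_measurable (lebesgue_on {0<..<T})"
      by (rule continuous_imp_measurable_on_sets_lebesgue) auto
    note um[measurable]
    show ?thesis unfolding z2_def by measurable
  qed
  show "ess_max T z2 \<le> ereal a"
    unfolding ess_max_def
  proof (rule esssup_I)
    show "(\<lambda>t. ereal (norm (z2 t))) \<in> borel_measurable (lebesgue_on {0<..<T})"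
      using meas by measurable
    show "AE t in lebesgue_on {0<..<T}. ereal (norm (z2 t)) \<le> ereal a"
      using u unfolding n2 by (intro AE_I2) (auto simp: bounded_meas_def)
  qed
  then have fin: "ess_max T z2 < \<infinity>" by (auto simp: less_top[symmetric])
  have "continuous_on {0..T} (\<lambda>t. (x t, y t))" "continuous_on {0..T} (\<lambda>t. (cos (\<theta> t), sin (\<theta> t)))"
    by (intro continuous_intros primitive_continuous[OF p(1)] primitive_continuous[OF p(2)] primitive_continuous[OF p(3)])+
  moreover have "weak_derivative T (\<lambda>t. (x t, y t)) (\<lambda>t. (cos (\<theta> t), sin (\<theta> t)))"
    by (rule primitive_weak_derivative) (use p T in auto)
  moreover have "weak_derivative T (\<lambda>t. (cos (\<theta> t), sin (\<theta> t))) z2"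
    unfolding z2_def by (rule primitive_weak_derivative) (use T primitive_cos[OF p(1)] primitive_sin[OF p(1)] in auto)
  moreover have "cos (\<theta> 0) = cos \<theta>0" "sin (\<theta> 0) = sin \<theta>0" "cos (\<theta> T) = cos \<theta>f" "sin (\<theta> T) = sin \<theta>f"
    using ends cos_rcong sin_rcong by blast+
  moreover have "norm (cos (\<theta> t), sin (\<theta> t)) = 1" for t
    by (simp add: norm_Pair)
  ultimately show "P_feasible z0 zf (cos \<theta>0, sin \<theta>0) (cos \<theta>f, sin \<theta>f) T (\<lambda>t. (x t, y t)) (\<lambda>t. (cos (\<theta> t), sin (\<theta> t))) z2"
    unfolding P_feasible_def W2_infty_def using meas fin ends by simp
qed

text \<open>
  Processes of (OC) give competitors in (P) whose essential maximum does not exceed \<open>\<alpha>\<close>, while for the given curve \<open>\<alpha>\<close> equals its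
  essential maximum.
\<close>
lemma P_solution_imp_OC_optimal:
  assumes P: "P_solution z0 zf (cos \<theta>0, sin \<theta>0) (cos \<theta>f, sin \<theta>f) T z z1 z2"
    and v: "control_of_curve z0 zf \<theta>0 \<theta>f T z z2 v" and T: "0 < T"
  obtains x y \<theta> \<alpha> where "OC_optimal z0 zf \<theta>0 \<theta>f T x y \<theta> \<alpha> v"
proof -
  obtain x y \<theta> \<alpha> where OC: "OC_feasible z0 zf \<theta>0 \<theta>f T x y \<theta> \<alpha> v"
    and ess: "\<And>t. t \<in> {0..T} \<Longrightarrow> ereal (\<alpha> t) = ess_max T z2"
    using v unfolding control_of_curve_def by blast
  obtain a u where a: "\<And>t. t \<in> {0..T} \<Longrightarrow> \<alpha> t = a"
    using OC_feasible_imp_curve[OF OC] T by (metis less_imp_le)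
  have "OC_cost T \<alpha> \<le> OC_cost T \<alpha>'" if OC': "OC_feasible z0 zf \<theta>0 \<theta>f T x' y' \<theta>' \<alpha>' v'" for x' y' \<theta>' \<alpha>' v'
  proof -
    obtain a' u' where a': "\<And>t. t \<in> {0..T} \<Longrightarrow> \<alpha>' t = a'" and c': "curvature_curve T a' u' x' y' \<theta>'"
      using OC_feasible_imp_curve[OF OC'] T by (metis less_imp_le)
    have ends: "(x' 0, y' 0) = z0" "[\<theta>' 0 = \<theta>0] (rmod (2 * pi))" "(x' T, y' T) = zf" "[\<theta>' T = \<theta>f] (rmod (2 * pi))"
      using OC' by (auto simp: OC_feasible_def)
    from P curve_P_feasible[OF c' T ends] have "ess_max T z2 \<le> ereal a'"
      unfolding P_solution_def using order_trans by blast
    moreover have "ess_max T z2 = ereal a" using ess[of 0] a[of 0] T by simp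
    ultimately have "a \<le> a'" by simp
    moreover have "OC_cost T \<alpha> = a * T" "OC_cost T \<alpha>' = a' * T"
      using a a' T by (auto intro!: OC_cost_constant)
    ultimately show ?thesis using T by simp
  qed
  with OC have "OC_optimal z0 zf \<theta>0 \<theta>f T x y \<theta> \<alpha> v" unfolding OC_optimal_def by blast
  then show thesis by (rule that)
qed

section \<open>Variations of the end point\<close>

lemma primitive_const: "primitive T (\<lambda>_. c) (\<lambda>_. 0)"
  unfolding primitive_def bounded_meas_def by auto

lemma primitive_integral:
  assumes "bounded_meas T C h"
  shows "primitive T (\<lambda>t. integral {0..t} h) h"
  using assms by (auto simp: primitive_def)

text \<open>
  Derivative, in the direction of the curvature variation \<open>h\<close>, of final angle, final abscissa and
  final ordinate: the angle changes by \<open>\<integral>h\<close>, hence \<open>cos \<theta>\<close> and \<open>sin \<theta>\<close> by \<open>- sin \<theta> \<integral>h\<close> and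
  \<open>cos \<theta> \<integral>h\<close>.
\<close>
definition endpoint_variation :: "real \<Rightarrow> (real \<Rightarrow> real) \<Rightarrow> (real \<Rightarrow> real) \<Rightarrow> real \<times> real \<times> real" where
  "endpoint_variation T \<theta> h =
     (integral {0..T} h,
      integral {0..T} (\<lambda>t. - sin (\<theta> t) * integral {0..t} h),
      integral {0..T} (\<lambda>t. cos (\<theta> t) * integral {0..t} h))"

lemma endpoint_variation_linear:
  assumes \<theta>: "continuous_on {0..T} \<theta>" and T: "0 \<le> T"
    and h: "bounded_meas T C h" and k: "bounded_meas T D k"
  shows "endpoint_variation T \<theta> (\<lambda>t. c * h t + d * k t) =
    c *\<^sub>R endpoint_variation T \<theta> h + d *\<^sub>R endpoint_variation T \<theta> k"
proof -
  have lin: "integral {0..t} (\<lambda>t. c * h t + d * k t) = c * integral {0..t} h + d * integral {0..t} k"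
    if "t \<in> {0..T}" for t
  proof -
    have "h integrable_on {0..t}" "k integrable_on {0..t}"
      using that by (auto intro: bounded_meas_integrable[OF h] bounded_meas_integrable[OF k])
    then show ?thesis by (simp add: integral_add integrable_on_mult_right)
  qed
  have cont: "continuous_on {0..T} (\<lambda>t. integral {0..t} h)" "continuous_on {0..T} (\<lambda>t. integral {0..t} k)"
    by (rule primitive_continuous[OF primitive_integral[OF h]] primitive_continuous[OF primitive_integral[OF k]])+
  have mom: "integral {0..T} (\<lambda>t. f t * integral {0..t} (\<lambda>t. c * h t + d * k t)) =
      c * integral {0..T} (\<lambda>t. f t * integral {0..t} h) + d * integral {0..T} (\<lambda>t. f t * integral {0..t} k)"
    if "continuous_on {0..T} f" for f
  proof -
    have i: "(\<lambda>t. f t * integral {0..t} h) integrable_on {0..T}" "(\<lambda>t. f t * integral {0..t} k) integrable_on {0..T}"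
      by (intro integrable_continuous_interval continuous_intros that cont)+
    have "integral {0..T} (\<lambda>t. f t * integral {0..t} (\<lambda>t. c * h t + d * k t)) =
      integral {0..T} (\<lambda>t. c * (f t * integral {0..t} h) + d * (f t * integral {0..t} k))"
      by (intro integral_cong) (simp add: lin algebra_simps)
    also have "\<dots> = c * integral {0..T} (\<lambda>t. f t * integral {0..t} h) + d * integral {0..T} (\<lambda>t. f t * integral {0..t} k)"
      using i by (simp only: integral_add integrable_on_mult_right integral_mult_right)
    finally show ?thesis .
  qed
  have c: "continuous_on {0..T} (\<lambda>t. - sin (\<theta> t))" "continuous_on {0..T} (\<lambda>t. cos (\<theta> t))"
    by (intro continuous_intros \<theta>)+
  show ?thesis
    unfolding endpoint_variation_def using mom[OF c(1)] mom[OF c(2)] lin[of T] T by simp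
qed

text \<open>
  Integration by parts turns a linear functional of the end point variation into a weighted mean
  of \<open>h\<close>; the weight \<open>\<psi>\<close> is the switching function.
\<close>
lemma endpoint_variation_moment:
  assumes \<psi>: "primitive T \<psi> (\<lambda>t. p1 * sin (\<theta> t) - p2 * cos (\<theta> t))" and \<theta>: "continuous_on {0..T} \<theta>"
    and h: "bounded_meas T C h" and T: "0 \<le> T"
  shows "(\<psi> T, p1, p2) \<bullet> endpoint_variation T \<theta> h = integral {0..T} (\<lambda>t. \<psi> t * h t)"
proof -
  let ?\<eta> = "\<lambda>t. integral {0..t} h"
  have c\<eta>: "continuous_on {0..T} ?\<eta>" by (rule primitive_continuous[OF primitive_integral[OF h]])
  have i: "(\<lambda>t. - sin (\<theta> t) * ?\<eta> t) integrable_on {0..T}" "(\<lambda>t. cos (\<theta> t) * ?\<eta> t) integrable_on {0..T}"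
    by (intro integrable_continuous_interval continuous_intros \<theta> c\<eta>)+
  have i\<psi>: "(\<lambda>t. (p1 * sin (\<theta> t) - p2 * cos (\<theta> t)) * ?\<eta> t) integrable_on {0..T}"
    by (intro integrable_continuous_interval continuous_intros \<theta> c\<eta>)
  obtain D where "bounded_meas T D \<psi>" by (rule bounded_meas_continuous[OF primitive_continuous[OF \<psi>]])
  then have "(\<lambda>t. \<psi> t * h t) integrable_on {0..T}"
    using bounded_meas_integrable[OF bounded_meas_mult[OF _ h]] by auto
  then have "\<psi> T * ?\<eta> T - \<psi> 0 * ?\<eta> 0
      = integral {0..T} (\<lambda>t. (p1 * sin (\<theta> t) - p2 * cos (\<theta> t)) * ?\<eta> t) + integral {0..T} (\<lambda>t. \<psi> t * h t)"
    using primitive_diff[OF primitive_mult[OF \<psi> primitive_integral[OF h]], of 0 T] T i\<psi>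
    by (simp add: integral_add)
  moreover have "integral {0..T} (\<lambda>t. (p1 * sin (\<theta> t) - p2 * cos (\<theta> t)) * ?\<eta> t)
      = integral {0..T} (\<lambda>t. (- p1) * (- sin (\<theta> t) * ?\<eta> t) + (- p2) * (cos (\<theta> t) * ?\<eta> t))"
    by (intro integral_cong) (simp add: algebra_simps)
  moreover have "\<dots> = (- p1) * integral {0..T} (\<lambda>t. - sin (\<theta> t) * ?\<eta> t) + (- p2) * integral {0..T} (\<lambda>t. cos (\<theta> t) * ?\<eta> t)"
    using i by (simp only: integral_add integrable_on_mult_right integral_mult_right)
  ultimately show ?thesis
    unfolding endpoint_variation_def inner_Pair by simp
qed

lemma norm_triple_le: "norm (a, b, c) \<le> \<bar>a\<bar> + \<bar>b\<bar> + \<bar>c\<bar>" for a b c :: real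
  using norm_Pair_le[of a "(b, c)"] norm_Pair_le[of b c] by simp

lemma integral_taylor_le:
  fixes F F' :: "real \<Rightarrow> real"
  assumes F: "\<And>x. (F has_real_derivative F' x) (at x)"
    and lip: "\<And>x y. \<bar>F' x - F' y\<bar> \<le> 1 * \<bar>x - y\<bar>"
    and cont: "continuous_on {0..T} \<theta>" "continuous_on {0..T} \<eta>" "continuous_on UNIV F'"
    and \<eta>: "\<And>t. t \<in> {0..T} \<Longrightarrow> \<bar>\<eta> t\<bar> \<le> m" and T: "0 \<le> T"
  shows "\<bar>integral {0..T} (\<lambda>t. F' (\<theta> t) * \<eta> t)
      - (integral {0..T} (\<lambda>t. F (\<theta> t + \<eta> t)) - integral {0..T} (\<lambda>t. F (\<theta> t)))\<bar> \<le> T * m\<^sup>2"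
proof -
  have F1: "continuous_on UNIV F"
    using F by (intro continuous_at_imp_continuous_on) (auto intro: DERIV_isCont)
  have c: "continuous_on {0..T} (\<lambda>t. F (\<theta> t + \<eta> t))" "continuous_on {0..T} (\<lambda>t. F (\<theta> t))"
      "continuous_on {0..T} (\<lambda>t. F' (\<theta> t) * \<eta> t)"
    by (intro continuous_intros cont continuous_on_compose2[OF F1] continuous_on_compose2[OF cont(3)]; simp)+
  have "integral {0..T} (\<lambda>t. F' (\<theta> t) * \<eta> t)
      - (integral {0..T} (\<lambda>t. F (\<theta> t + \<eta> t)) - integral {0..T} (\<lambda>t. F (\<theta> t)))
      = integral {0..T} (\<lambda>t. F' (\<theta> t) * \<eta> t - (F (\<theta> t + \<eta> t) - F (\<theta> t)))"
    using c[THEN integrable_continuous_interval] by (simp add: integral_diff integrable_diff)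
  also have "norm \<dots> \<le> integral {0..T} (\<lambda>_. m\<^sup>2)"
  proof (rule integral_norm_bound_integral)
    show "(\<lambda>t. F' (\<theta> t) * \<eta> t - (F (\<theta> t + \<eta> t) - F (\<theta> t))) integrable_on {0..T}"
      by (intro integrable_diff c[THEN integrable_continuous_interval])
    show "norm (F' (\<theta> t) * \<eta> t - (F (\<theta> t + \<eta> t) - F (\<theta> t))) \<le> m\<^sup>2" if "t \<in> {0..T}" for t
    proof -
      have "\<bar>F (\<theta> t + \<eta> t) - F (\<theta> t) - F' (\<theta> t) * (\<theta> t + \<eta> t - \<theta> t)\<bar> \<le> 1 * (\<theta> t + \<eta> t - \<theta> t)\<^sup>2"
        by (rule taylor_quadratic[OF F lip])
      also have "\<dots> \<le> m\<^sup>2" using \<eta>[OF that] by (simp add: abs_le_square_iff[symmetric])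
      finally show ?thesis by (simp add: abs_minus_commute)
    qed
  qed (simp add: integrable_const_ivl)
  finally show ?thesis using T by simp
qed

text \<open>
  The ends of the curve can be kept with a smaller bound on the curvature.
\<close>
definition reducible :: "real \<Rightarrow> real \<Rightarrow> (real \<Rightarrow> real) \<Rightarrow> (real \<Rightarrow> real) \<Rightarrow> bool" where
  "reducible T a u \<theta> \<longleftrightarrow> (\<exists>a' h C. 0 < a' \<and> a' < a \<and>
     bounded_meas T a' (\<lambda>t. u t + h t) \<and> bounded_meas T C h \<and> integral {0..T} h = 0 \<and>
     integral {0..T} (\<lambda>t. cos (\<theta> t + integral {0..t} h)) = integral {0..T} (\<lambda>t. cos (\<theta> t)) \<and>
     integral {0..T} (\<lambda>t. sin (\<theta> t + integral {0..t} h)) = integral {0..T} (\<lambda>t. sin (\<theta> t)))"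

text \<open>
  A smaller control \<open>w\<close> with the right first-order effect is moved towards by a fraction \<open>\<epsilon>\<close>, which
  gains \<open>\<epsilon> (a - b)\<close> in the bound and spoils the end conditions by \<open>O(\<epsilon>\<^sup>2)\<close>.  The error is repaired
  by controls \<open>d1\<close>, \<open>d2\<close>, \<open>d3\<close> acting on the three end coordinates with a coefficient vector \<open>q\<close> of
  size \<open>\<kappa> \<epsilon>\<close>: the map from \<open>q\<close> to the exact change of the end point differs from the identity by
  \<open>O(\<epsilon>\<^sup>2) \<le> \<kappa> \<epsilon>\<close> on that ball, so by Brouwer's theorem it takes the value \<open>0\<close> there.  The repair
  costs only half of the gain.
\<close>
lemma competitor_by_brouwer:
  assumes T: "0 < T" and a: "0 < a" and u: "bounded_meas T a u" and \<theta>: "primitive T \<theta> u"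
    and w: "bounded_meas T b w" "b < a" "endpoint_variation T \<theta> w = endpoint_variation T \<theta> u"
    and onto: "\<And>q. \<exists>C h. bounded_meas T C h \<and> endpoint_variation T \<theta> h = q"
  shows "reducible T a u \<theta>"
proof -
  note c\<theta> = primitive_continuous[OF \<theta>]
  obtain C1 C2 C3 d1 d2 d3 where d0: "bounded_meas T C1 d1" "bounded_meas T C2 d2" "bounded_meas T C3 d3"
    and Ld: "endpoint_variation T \<theta> d1 = (1, 0, 0)" "endpoint_variation T \<theta> d2 = (0, 1, 0)"
      "endpoint_variation T \<theta> d3 = (0, 0, 1)"
    using onto[of "(1, 0, 0)"] onto[of "(0, 1, 0)"] onto[of "(0, 0, 1)"] by metis
  define C where "C = Max {a, b, C1, C2, C3}"
  have C: "a \<le> C" "b \<le> C" "C1 \<le> C" "C2 \<le> C" "C3 \<le> C" by (auto simp: C_def)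
  have C0: "0 < C" using C a by linarith
  have d: "bounded_meas T C d1" "bounded_meas T C d2" "bounded_meas T C d3"
    using d0 C by (auto intro: bounded_meas_mono)
  have b: "0 \<le> b" using w(1) T unfolding bounded_meas_def by (metis abs_ge_zero atLeastAtMost_iff less_imp_le order.refl order_trans)
  define M where "M = 5 * C * T"
  have M: "0 < M" using C0 T by (simp add: M_def)
  \<comment> \<open>the correction of size \<open>\<kappa> \<epsilon>\<close> may use up at most half of the gain \<open>\<epsilon> (a - b)\<close>\<close>
  define \<kappa> where "\<kappa> = min 1 ((a - b) / (6 * C))"
  have \<kappa>: "0 < \<kappa>" "\<kappa> \<le> 1" "3 * \<kappa> * C \<le> (a - b) / 2"
  proof -
    show "0 < \<kappa>" "\<kappa> \<le> 1" using C0 w(2) by (auto simp: \<kappa>_def)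
    have "\<kappa> \<le> (a - b) / (6 * C)" by (simp add: \<kappa>_def)
    then show "3 * \<kappa> * C \<le> (a - b) / 2" using C0 by (simp add: field_simps)
  qed
  \<comment> \<open>the quadratic error \<open>2 T (\<epsilon> M)\<^sup>2\<close> has to fit into the ball of radius \<open>\<kappa> \<epsilon>\<close>\<close>
  define \<epsilon> where "\<epsilon> = min 1 (\<kappa> / (2 * T * M\<^sup>2))"
  have \<epsilon>: "0 < \<epsilon>" "\<epsilon> \<le> 1" "2 * T * (\<epsilon> * M)\<^sup>2 \<le> \<kappa> * \<epsilon>"
  proof -
    show "0 < \<epsilon>" "\<epsilon> \<le> 1" using \<kappa> T M by (auto simp: \<epsilon>_def)
    have "\<epsilon> \<le> \<kappa> / (2 * T * M\<^sup>2)" by (simp add: \<epsilon>_def)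
    then have "\<epsilon> * (2 * T * M\<^sup>2) \<le> \<kappa>" using T M by (simp add: field_simps)
    then have "\<epsilon> * (2 * T * M\<^sup>2) * \<epsilon> \<le> \<kappa> * \<epsilon>" using \<open>0 < \<epsilon>\<close> by (intro mult_right_mono) auto
    then show "2 * T * (\<epsilon> * M)\<^sup>2 \<le> \<kappa> * \<epsilon>" by (simp add: power2_eq_square mult_ac)
  qed
  \<comment> \<open>the factors \<open>1\<close> and \<open>-1\<close> fit the shape of the linearity lemma\<close>
  define h where "h q t = \<epsilon> * (1 * w t + (-1) * u t) + 1 * (fst q * d1 t + 1 * (fst (snd q) * d2 t + snd (snd q) * d3 t))"
    for q :: "real \<times> real \<times> real" and t
  define \<eta> where "\<eta> q t = integral {0..t} (h q)" for q t
  have wu: "bounded_meas T (2 * C) (\<lambda>t. 1 * w t + (-1) * u t)"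
    using bounded_meas_add[OF bounded_meas_cmult[OF bounded_meas_mono[OF w(1) C(2)], of 1]
        bounded_meas_cmult[OF bounded_meas_mono[OF u C(1)], of "-1"]] by simp
  have D23: "bounded_meas T (\<bar>fst (snd q)\<bar> * C + \<bar>snd (snd q)\<bar> * C) (\<lambda>t. fst (snd q) * d2 t + snd (snd q) * d3 t)"
    for q :: "real \<times> real \<times> real"
    by (intro bounded_meas_add bounded_meas_cmult d)
  have D: "bounded_meas T (\<bar>fst q\<bar> * C + (\<bar>fst (snd q)\<bar> * C + \<bar>snd (snd q)\<bar> * C))
      (\<lambda>t. fst q * d1 t + 1 * (fst (snd q) * d2 t + snd (snd q) * d3 t))"
    for q :: "real \<times> real \<times> real"
    using bounded_meas_add[OF bounded_meas_cmult[OF d(1)] D23] by simp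
  have comp: "\<bar>fst q\<bar> \<le> norm q" "\<bar>fst (snd q)\<bar> \<le> norm q" "\<bar>snd (snd q)\<bar> \<le> norm q" for q :: "real \<times> real \<times> real"
    using norm_fst_le[of "fst q" "snd q"] norm_snd_le[of "snd q" "fst q"]
      norm_fst_le[of "fst (snd q)" "snd (snd q)"] norm_snd_le[of "snd (snd q)" "fst (snd q)"] by auto
  have D': "bounded_meas T (3 * (\<kappa> * \<epsilon>) * C) (\<lambda>t. fst q * d1 t + 1 * (fst (snd q) * d2 t + snd (snd q) * d3 t))"
    if "norm q \<le> \<kappa> * \<epsilon>" for q :: "real \<times> real \<times> real"
  proof (rule bounded_meas_mono[OF D])
    have "\<bar>fst q\<bar> \<le> \<kappa> * \<epsilon>" "\<bar>fst (snd q)\<bar> \<le> \<kappa> * \<epsilon>" "\<bar>snd (snd q)\<bar> \<le> \<kappa> * \<epsilon>"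
      using comp[of q] that by auto
    then have "(\<bar>fst q\<bar> + \<bar>fst (snd q)\<bar> + \<bar>snd (snd q)\<bar>) * C \<le> (3 * (\<kappa> * \<epsilon>)) * C"
      using C0 by (intro mult_right_mono) auto
    then show "\<bar>fst q\<bar> * C + (\<bar>fst (snd q)\<bar> * C + \<bar>snd (snd q)\<bar> * C) \<le> 3 * (\<kappa> * \<epsilon>) * C"
      by (simp add: algebra_simps)
  qed
  have hb: "bounded_meas T (5 * C * \<epsilon>) (h q)" if q: "norm q \<le> \<kappa> * \<epsilon>" for q
  proof -
    have "bounded_meas T (\<bar>\<epsilon>\<bar> * (2 * C) + 3 * (\<kappa> * \<epsilon>) * C) (h q)"
      unfolding h_def using bounded_meas_add[OF bounded_meas_cmult[OF wu] D'[OF q]] by simp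
    moreover have "\<bar>\<epsilon>\<bar> * (2 * C) + 3 * (\<kappa> * \<epsilon>) * C \<le> 5 * C * \<epsilon>"
    proof -
      have "\<kappa> * (\<epsilon> * C) \<le> 1 * (\<epsilon> * C)" using \<kappa> \<epsilon> C0 by (intro mult_right_mono) auto
      then show ?thesis using \<epsilon> by (simp add: algebra_simps)
    qed
    ultimately show ?thesis by (rule bounded_meas_mono)
  qed
  have Lh: "endpoint_variation T \<theta> (h q) = q" for q
  proof -
    have T0: "0 \<le> T" using T by simp
    note lin = endpoint_variation_linear[OF c\<theta> T0]
    have "endpoint_variation T \<theta> (h q) = \<epsilon> *\<^sub>R (1 *\<^sub>R endpoint_variation T \<theta> w + (-1) *\<^sub>R endpoint_variation T \<theta> u)
      + 1 *\<^sub>R (fst q *\<^sub>R endpoint_variation T \<theta> d1 + 1 *\<^sub>R (fst (snd q) *\<^sub>R endpoint_variation T \<theta> d2 + snd (snd q) *\<^sub>R endpoint_variation T \<theta> d3))"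
      unfolding h_def lin[OF wu D] lin[OF w(1) u] lin[OF d(1) D23] lin[OF d(2,3)] ..
    then show ?thesis by (cases q rule: prod_cases3) (simp add: w(3) Ld)
  qed
  have \<eta>eq: "\<eta> q t = \<epsilon> * integral {0..t} (\<lambda>t. 1 * w t + (-1) * u t) + (fst q * integral {0..t} d1
      + (fst (snd q) * integral {0..t} d2 + snd (snd q) * integral {0..t} d3))" if t: "t \<in> {0..T}" for q t
  proof -
    have i: "(\<lambda>t. 1 * w t + (-1) * u t) integrable_on {0..t}" "d1 integrable_on {0..t}"
        "d2 integrable_on {0..t}" "d3 integrable_on {0..t}"
      using t bounded_meas_integrable[OF wu, of 0 t] bounded_meas_integrable[OF d(1), of 0 t]
          bounded_meas_integrable[OF d(2), of 0 t] bounded_meas_integrable[OF d(3), of 0 t] by simp_all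
    show ?thesis unfolding \<eta>_def h_def
      using i by (simp only: integral_add integrable_on_mult_right integral_mult_right integrable_add mult_1)
  qed
  have \<eta>c: "continuous_on {0..T} (\<eta> q)" if "norm q \<le> \<kappa> * \<epsilon>" for q
    unfolding \<eta>_def by (rule primitive_continuous[OF primitive_integral[OF hb[OF that]]])
  have \<eta>b: "\<bar>\<eta> q t\<bar> \<le> \<epsilon> * M" if q: "norm q \<le> \<kappa> * \<epsilon>" and t: "t \<in> {0..T}" for q t
  proof -
    have "\<bar>\<eta> q t\<bar> \<le> 5 * C * \<epsilon> * (t - 0)"
      unfolding \<eta>_def using t by (intro bounded_meas_integral_le[OF hb[OF q]]) auto
    also have "\<dots> \<le> 5 * C * \<epsilon> * T" using t C0 \<epsilon> by (intro mult_left_mono) auto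
    finally show ?thesis by (simp add: M_def mult_ac)
  qed
  define \<Phi> where "\<Phi> q = (\<eta> q T, integral {0..T} (\<lambda>t. cos (\<theta> t + \<eta> q t)) - integral {0..T} (\<lambda>t. cos (\<theta> t)),
     integral {0..T} (\<lambda>t. sin (\<theta> t + \<eta> q t)) - integral {0..T} (\<lambda>t. sin (\<theta> t)))" for q
  have small: "norm (q - \<Phi> q) \<le> \<kappa> * \<epsilon>" if q: "norm q \<le> \<kappa> * \<epsilon>" for q
  proof -
    have "norm (endpoint_variation T \<theta> (h q) - \<Phi> q) \<le> \<bar>\<eta> q T - \<eta> q T\<bar>
       + \<bar>integral {0..T} (\<lambda>t. - sin (\<theta> t) * \<eta> q t) - (integral {0..T} (\<lambda>t. cos (\<theta> t + \<eta> q t)) - integral {0..T} (\<lambda>t. cos (\<theta> t)))\<bar>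
       + \<bar>integral {0..T} (\<lambda>t. cos (\<theta> t) * \<eta> q t) - (integral {0..T} (\<lambda>t. sin (\<theta> t + \<eta> q t)) - integral {0..T} (\<lambda>t. sin (\<theta> t)))\<bar>"
      unfolding endpoint_variation_def \<Phi>_def \<eta>_def[symmetric] diff_Pair by (rule norm_triple_le)
    also have "\<dots> \<le> 0 + T * (\<epsilon> * M)\<^sup>2 + T * (\<epsilon> * M)\<^sup>2"
    proof (rule add_mono[OF add_mono])
      show "\<bar>integral {0..T} (\<lambda>t. - sin (\<theta> t) * \<eta> q t) - (integral {0..T} (\<lambda>t. cos (\<theta> t + \<eta> q t)) - integral {0..T} (\<lambda>t. cos (\<theta> t)))\<bar> \<le> T * (\<epsilon> * M)\<^sup>2"
      proof (rule integral_taylor_le[where F = cos and F' = "\<lambda>x. - sin x" and \<eta> = "\<eta> q" and \<theta> = \<theta> and m = "\<epsilon> * M" and T = T])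
        show "\<bar>- sin x - - sin y\<bar> \<le> 1 * \<bar>x - y\<bar>" for x y :: real
          using sin_cos_lipschitz(1)[of x y] by linarith
        show "(cos has_real_derivative - sin x) (at x)" for x :: real
          by (auto intro!: derivative_eq_intros)
        show "continuous_on UNIV (\<lambda>x::real. - sin x)" by (intro continuous_intros)
      qed (use T c\<theta> \<eta>c[OF q] \<eta>b[OF q] in auto)
      show "\<bar>integral {0..T} (\<lambda>t. cos (\<theta> t) * \<eta> q t) - (integral {0..T} (\<lambda>t. sin (\<theta> t + \<eta> q t)) - integral {0..T} (\<lambda>t. sin (\<theta> t)))\<bar> \<le> T * (\<epsilon> * M)\<^sup>2"
      proof (rule integral_taylor_le[where F = sin and F' = cos and \<eta> = "\<eta> q" and \<theta> = \<theta> and m = "\<epsilon> * M" and T = T])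
        show "\<bar>cos x - cos y\<bar> \<le> 1 * \<bar>x - y\<bar>" for x y :: real
          by (rule sin_cos_lipschitz(2))
        show "(sin has_real_derivative cos x) (at x)" for x :: real
          by (auto intro!: derivative_eq_intros)
        show "continuous_on UNIV (cos :: real \<Rightarrow> real)" by (intro continuous_intros)
      qed (use T c\<theta> \<eta>c[OF q] \<eta>b[OF q] in auto)
    qed simp
    also have "\<dots> \<le> \<kappa> * \<epsilon>" using \<epsilon>(3) by simp
    finally show ?thesis by (simp only: Lh)
  qed
  let ?S = "cball (0 :: real \<times> real \<times> real) (\<kappa> * \<epsilon>)"
  have \<eta>cc: "continuous_on (?S \<times> cbox 0 T) (\<lambda>(q, t). \<theta> t + \<eta> q t)"
  proof -
    have s: "continuous_on (?S \<times> cbox 0 T) (\<lambda>z. f (snd z))" if "continuous_on {0..T} f" for f :: "real \<Rightarrow> real"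
      by (rule continuous_on_compose2[OF that]) (auto intro!: continuous_intros)
    have "continuous_on (?S \<times> cbox 0 T) (\<lambda>z. \<theta> (snd z) + (\<epsilon> * integral {0..snd z} (\<lambda>t. 1 * w t + (-1) * u t) + (fst (fst z) * integral {0..snd z} d1
      + (fst (snd (fst z)) * integral {0..snd z} d2 + snd (snd (fst z)) * integral {0..snd z} d3))))"
      by (intro continuous_intros s c\<theta> primitive_continuous[OF primitive_integral[OF wu]] primitive_continuous[OF primitive_integral[OF d(1)]]
          primitive_continuous[OF primitive_integral[OF d(2)]] primitive_continuous[OF primitive_integral[OF d(3)]])
    then show ?thesis
      by (rule continuous_on_eq) (auto simp: \<eta>eq simp del: mult_1 mult_minus1)
  qed
  have cF: "continuous_on ?S (\<lambda>q. integral {0..T} (\<lambda>t. F (\<theta> t + \<eta> q t)))" if "continuous_on UNIV F" for F :: "real \<Rightarrow> real"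
  proof -
    have "continuous_on (?S \<times> cbox 0 T) (\<lambda>(q, t). F (\<theta> t + \<eta> q t))"
      using continuous_on_compose2[OF that \<eta>cc] by (simp add: case_prod_unfold)
    then show ?thesis using integral_continuous_on_param by fastforce
  qed
  have "continuous_on ?S (\<lambda>q. \<eta> q T)"
    using T by (simp only: \<eta>eq atLeastAtMost_iff order.refl less_imp_le conj_absorb simp_thms) (intro continuous_intros)
  then have cont: "continuous_on ?S (\<lambda>q. q - \<Phi> q)"
    unfolding \<Phi>_def by (intro continuous_intros cF)
  have self: "(\<lambda>q. q - \<Phi> q) \<in> ?S \<rightarrow> ?S"
    using small by (intro funcsetI) (simp only: mem_cball_0)
  have "0 < \<kappa> * \<epsilon>" using \<kappa> \<epsilon> by simp
  then have ne: "?S \<noteq> {}" by simp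
  obtain q where q: "q \<in> ?S" "q - \<Phi> q = q"
    by (rule brouwer[OF compact_cball convex_cball ne cont self])
  then have qn: "norm q \<le> \<kappa> * \<epsilon>" by simp
  have "\<Phi> q = q - (q - \<Phi> q)" by (simp only: diff_diff_eq2 add_diff_cancel_left')
  then have \<Phi>0: "\<Phi> q = 0" by (simp only: q(2) diff_self)
  define a' where "a' = a - \<epsilon> * (a - b) / 2"
  have "\<epsilon> * (a - b) \<le> 1 * (a - b)" using \<epsilon> w(2) by (intro mult_right_mono) auto
  moreover have "0 < \<epsilon> * (a - b)" using \<epsilon> w(2) by simp
  ultimately have "\<epsilon> * (a - b) / 2 < a \<and> 0 < \<epsilon> * (a - b) / 2" using a b by auto
  then have a': "0 < a'" "a' < a" unfolding a'_def by auto
  have "bounded_meas T a' (\<lambda>t. u t + h q t)"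
  proof -
    have "bounded_meas T ((\<bar>1 - \<epsilon>\<bar> * a + \<bar>\<epsilon>\<bar> * b) + 3 * (\<kappa> * \<epsilon>) * C)
       (\<lambda>t. ((1 - \<epsilon>) * u t + \<epsilon> * w t) + (fst q * d1 t + 1 * (fst (snd q) * d2 t + snd (snd q) * d3 t)))"
      by (intro bounded_meas_add bounded_meas_cmult u w(1) D'[OF qn, simplified] D'[OF qn])
    moreover have "(\<bar>1 - \<epsilon>\<bar> * a + \<bar>\<epsilon>\<bar> * b) + 3 * (\<kappa> * \<epsilon>) * C \<le> a'"
    proof -
      have "\<epsilon> * (3 * \<kappa> * C) \<le> \<epsilon> * ((a - b) / 2)" using \<kappa>(3) \<epsilon>(1) by (intro mult_left_mono) auto
      then show ?thesis using \<epsilon> by (simp add: a'_def field_simps)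
    qed
    moreover have "(\<lambda>t. ((1 - \<epsilon>) * u t + \<epsilon> * w t) + (fst q * d1 t + 1 * (fst (snd q) * d2 t + snd (snd q) * d3 t))) = (\<lambda>t. u t + h q t)"
      by (intro ext) (simp add: h_def algebra_simps)
    ultimately show ?thesis using bounded_meas_mono by metis
  qed
  then show ?thesis
    using a' hb[OF qn] \<Phi>0 unfolding reducible_def \<Phi>_def \<eta>_def zero_prod_def
    by (intro exI[of _ a'] exI[of _ "h q"] exI[of _ "5 * C * \<epsilon>"]) simp
qed

section \<open>The maximum principle\<close>

text \<open>
  A curve that is not reducible falls under one of two cases.  Either no control of smaller norm has the first-order effect of
  \<open>u\<close>, and the convex set of the effects of smaller controls is separated from that of \<open>u\<close>; or the
  variations do not span the three end coordinates, and a vector orthogonal to all of them serves.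
\<close>
lemma separation_from_smaller_controls:
  assumes T: "0 < T" and a: "0 < a" and u: "bounded_meas T a u" and \<theta>: "primitive T \<theta> u"
    and min: "\<not> reducible T a u \<theta>"
  obtains n where "n \<noteq> 0" "\<And>b w. b < a \<Longrightarrow> bounded_meas T b w \<Longrightarrow>
      n \<bullet> endpoint_variation T \<theta> w \<le> n \<bullet> endpoint_variation T \<theta> u"
proof -
  let ?L = "endpoint_variation T \<theta>"
  note c\<theta> = primitive_continuous[OF \<theta>]
  have T0: "0 \<le> T" using T by simp
  note lin = endpoint_variation_linear[OF c\<theta> T0]
  have L0: "?L (\<lambda>_. 0) = 0" by (simp add: endpoint_variation_def zero_prod_def)
  have m0: "bounded_meas T 0 (\<lambda>_. 0)" by (simp add: bounded_meas_def)
  define M where "M = {?L w | w b. b < a \<and> bounded_meas T b w}"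
  show thesis
  proof (cases "?L u \<in> M")
    case False
    have cM: "convex M"
    proof (rule convexI)
      fix p q :: "real \<times> real \<times> real" and r s :: real
      assume p: "p \<in> M" and q: "q \<in> M" and rs: "0 \<le> r" "0 \<le> s" "r + s = 1"
      obtain w1 b1 where 1: "p = ?L w1" "b1 < a" "bounded_meas T b1 w1" using p by (auto simp: M_def)
      obtain w2 b2 where 2: "q = ?L w2" "b2 < a" "bounded_meas T b2 w2" using q by (auto simp: M_def)
      have "r *\<^sub>R p + s *\<^sub>R q = ?L (\<lambda>t. r * w1 t + s * w2 t)" by (simp only: 1(1) 2(1) lin[OF 1(3) 2(3)])
      moreover have "bounded_meas T (\<bar>r\<bar> * b1 + \<bar>s\<bar> * b2) (\<lambda>t. r * w1 t + s * w2 t)"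
        by (intro bounded_meas_add bounded_meas_cmult 1 2)
      moreover have "\<bar>r\<bar> * b1 + \<bar>s\<bar> * b2 < a"
      proof -
        have "\<bar>r\<bar> * b1 + \<bar>s\<bar> * b2 \<le> r * max b1 b2 + s * max b1 b2"
          using rs by (intro add_mono) (auto intro: mult_left_mono)
        also have "\<dots> = max b1 b2" using rs(3) by (metis distrib_right mult_1)
        finally show ?thesis using 1 2 by simp
      qed
      ultimately show "r *\<^sub>R p + s *\<^sub>R q \<in> M" unfolding M_def by blast
    qed
    have "0 \<in> M" unfolding M_def using L0 m0 a by force
    then have "\<exists>n \<beta>. n \<noteq> 0 \<and> (\<forall>q\<in>M. n \<bullet> q \<le> \<beta>) \<and> (\<forall>q\<in>{?L u}. \<beta> \<le> n \<bullet> q)"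
      using False by (intro separating_hyperplane_sets[OF cM]) auto
    then obtain n \<beta> where n: "n \<noteq> 0" "\<And>q. q \<in> M \<Longrightarrow> n \<bullet> q \<le> \<beta>" "\<beta> \<le> n \<bullet> ?L u" by blast
    show thesis
    proof (rule that[OF n(1)])
      fix b w assume "b < a" "bounded_meas T b w"
      then have "?L w \<in> M" by (auto simp: M_def)
      from n(2)[OF this] n(3) show "n \<bullet> ?L w \<le> n \<bullet> ?L u" by (rule order_trans)
    qed
  next
    case True
    then obtain w b where w: "bounded_meas T b w" "b < a" "?L w = ?L u" by (auto simp: M_def)
    define V where "V = {?L h | h C. bounded_meas T C h}"
    have "subspace V"
    proof (rule subspaceI)
      show "0 \<in> V" unfolding V_def using L0 m0 by force
    next
      fix p q assume p: "p \<in> V" and q: "q \<in> V"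
      obtain w1 b1 where 1: "p = ?L w1" "bounded_meas T b1 w1" using p by (auto simp: V_def)
      obtain w2 b2 where 2: "q = ?L w2" "bounded_meas T b2 w2" using q by (auto simp: V_def)
      have "p + q = ?L (\<lambda>t. 1 * w1 t + 1 * w2 t)" unfolding 1(1) 2(1) lin[OF 1(2) 2(2)] by simp
      moreover have "bounded_meas T (\<bar>1\<bar> * b1 + \<bar>1\<bar> * b2) (\<lambda>t. 1 * w1 t + 1 * w2 t)"
        by (intro bounded_meas_add bounded_meas_cmult 1 2)
      ultimately show "p + q \<in> V" unfolding V_def by blast
    next
      fix p and r :: real assume p: "p \<in> V"
      obtain w1 b1 where 1: "p = ?L w1" "bounded_meas T b1 w1" using p by (auto simp: V_def)
      have "r *\<^sub>R p = ?L (\<lambda>t. r * w1 t + 0 * w1 t)" unfolding 1(1) lin[OF 1(2) 1(2)] by simp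
      moreover have "bounded_meas T (\<bar>r\<bar> * b1 + \<bar>0\<bar> * b1) (\<lambda>t. r * w1 t + 0 * w1 t)"
        by (intro bounded_meas_add bounded_meas_cmult 1)
      ultimately show "r *\<^sub>R p \<in> V" unfolding V_def by blast
    qed
    then have spanV: "span V = V" by simp
    have "V \<noteq> UNIV"
    proof
      assume "V = UNIV"
      have onto: "\<exists>C h. bounded_meas T C h \<and> ?L h = q" for q
      proof -
        have "q \<in> V" by (simp add: \<open>V = UNIV\<close>)
        then show ?thesis unfolding V_def by blast
      qed
      from competitor_by_brouwer[OF T a u \<theta> w onto] min show False by contradiction
    qed
    then have "dim V < DIM(real \<times> real \<times> real)"
      using dim_eq_full[of V] dim_subset_UNIV[of V] spanV by (metis le_neq_implies_less)
    then obtain n where n: "n \<noteq> 0" "\<And>q. q \<in> span V \<Longrightarrow> orthogonal n q"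
      using orthogonal_to_subspace_exists by metis
    have z: "n \<bullet> ?L h = 0" if "bounded_meas T C h" for C h
    proof -
      have "?L h \<in> V" unfolding V_def using that by blast
      with n(2)[of "?L h"] show ?thesis by (simp only: spanV orthogonal_def)
    qed
    show thesis
      by (rule that[OF n(1)]) (simp add: z[OF u] z)
  qed
qed

lemma AE_zero_if_integral_nonpos:
  assumes g: "bounded_meas T C g" and g0: "\<And>t. t \<in> {0..T} \<Longrightarrow> 0 \<le> g t"
    and le: "integral {0..T} g \<le> 0"
  shows "AE t in lebesgue. t \<in> {0..T} \<longrightarrow> g t = 0"
proof -
  have "0 \<le> integral {0..T} g" using g0 by (intro integral_nonneg bounded_meas_integrable[OF g]) auto
  with le have "integral {0..T} g = 0" by simp
  then have "has_bochner_integral (lebesgue_on {0<..<T}) g 0"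
    using bounded_meas_has_bochner_integral[OF g] by simp
  then have "AE t in lebesgue_on {0<..<T}. g t = 0"
    using g0 by (subst (asm) has_bochner_integral_iff, subst integral_nonneg_eq_0_iff_AE[symmetric]) (auto intro!: AE_I2)
  then have "AE t in lebesgue. t \<in> {0<..<T} \<longrightarrow> g t = 0" by (simp add: AE_lebesgue_on_iff)
  moreover have "AE t in lebesgue. t \<notin> {0, T}"
  proof -
    have "negligible {0, T}" by simp
    then show ?thesis unfolding eventually_ae_filter_negligible by blast
  qed
  ultimately show ?thesis
    by (rule eventually_elim2) auto
qed

text \<open>
  Comparison with \<open>z a\<close> times the sign of \<open>\<psi>\<close>, for \<open>z\<close> tending to \<open>1\<close>, gives
  \<open>a \<integral>\<bar>\<psi>\<bar> \<le> \<integral>\<psi> u\<close>, whereas \<open>\<psi> u \<le> a \<bar>\<psi>\<bar>\<close> holds pointwise.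
\<close>
lemma saturated_control:
  assumes T: "0 \<le> T" and a: "0 \<le> a" and u: "bounded_meas T a u" and \<psi>: "continuous_on {0..T} \<psi>"
    and max: "\<And>b w. b < a \<Longrightarrow> bounded_meas T b w \<Longrightarrow>
       integral {0..T} (\<lambda>t. \<psi> t * w t) \<le> integral {0..T} (\<lambda>t. \<psi> t * u t)"
  shows "AE t in lebesgue. t \<in> {0..T} \<longrightarrow> \<psi> t * u t = a * \<bar>\<psi> t\<bar>"
proof (cases "a = 0")
  case True
  then show ?thesis using u by (auto simp: bounded_meas_def)
next
  case False
  then have a: "0 < a" using a by simp
  obtain K where K: "bounded_meas T K \<psi>" by (rule bounded_meas_continuous[OF \<psi>])
  obtain K' where K': "bounded_meas T K' (\<lambda>t. \<bar>\<psi> t\<bar>)"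
    by (rule bounded_meas_continuous[of T "\<lambda>t. \<bar>\<psi> t\<bar>"]) (intro continuous_intros \<psi>)
  have [measurable]: "\<psi> \<in> borel_measurable (lebesgue_on {0..T})" using K by (simp add: bounded_meas_def)
  let ?I = "integral {0..T} (\<lambda>t. \<bar>\<psi> t\<bar>)"
  have "a * ?I \<le> integral {0..T} (\<lambda>t. \<psi> t * u t)"
  proof (rule field_le_mult_one_interval)
    fix z :: real assume z: "0 < z" "z < 1"
    define w where "w t = (if 0 \<le> \<psi> t then z * a else - (z * a))" for t
    have "bounded_meas T (z * a) w"
      unfolding bounded_meas_def
    proof
      show "w \<in> borel_measurable (lebesgue_on {0..T})" unfolding w_def by measurable
    qed (use z a in \<open>auto simp: w_def\<close>)
    then have "integral {0..T} (\<lambda>t. \<psi> t * w t) \<le> integral {0..T} (\<lambda>t. \<psi> t * u t)"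
      using z a by (intro max) auto
    moreover have "(\<lambda>t. \<psi> t * w t) = (\<lambda>t. (z * a) * \<bar>\<psi> t\<bar>)" by (auto simp: w_def)
    ultimately show "z * (a * ?I) \<le> integral {0..T} (\<lambda>t. \<psi> t * u t)" by (simp add: mult.assoc)
  qed
  moreover define g where "g t = a * \<bar>\<psi> t\<bar> + (- 1) * (\<psi> t * u t)" for t
  have g: "bounded_meas T (\<bar>a\<bar> * K' + \<bar>- 1\<bar> * (K * a)) g"
    unfolding g_def by (intro bounded_meas_add bounded_meas_cmult bounded_meas_mult K K' u)
  have "integral {0..T} g = a * ?I - integral {0..T} (\<lambda>t. \<psi> t * u t)"
    unfolding g_def using bounded_meas_integrable[OF K', of 0 T] bounded_meas_integrable[OF bounded_meas_mult[OF K u], of 0 T]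
    by (simp add: integral_diff integrable_on_mult_right)
  ultimately have "integral {0..T} g \<le> 0" by simp
  moreover have g0: "0 \<le> g t" if "t \<in> {0..T}" for t
  proof -
    have "\<psi> t * u t \<le> \<bar>\<psi> t\<bar> * \<bar>u t\<bar>" by (simp only: abs_ge_self flip: abs_mult)
    also have "\<dots> \<le> \<bar>\<psi> t\<bar> * a" using u that by (intro mult_left_mono) (auto simp: bounded_meas_def)
    finally have "\<psi> t * u t \<le> \<bar>\<psi> t\<bar> * a" .
    then show ?thesis by (simp add: g_def mult.commute)
  qed
  ultimately have "AE t in lebesgue. t \<in> {0..T} \<longrightarrow> g t = 0"
    by (intro AE_zero_if_integral_nonpos[OF g]) auto
  then show ?thesis by (rule eventually_mono) (auto simp: g_def)
qed

text \<open>
  If \<open>p1 = p2 = 0\<close> then \<open>\<psi>\<close> is a nonzero constant, which the last alternative records.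
\<close>
lemma maximum_principle:
  assumes T: "0 < T" and a: "0 < a" and c: "curvature_curve T a u x y \<theta>"
    and min: "\<not> reducible T a u \<theta>"
  obtains p1 p2 \<psi> where "primitive T \<psi> (\<lambda>t. p1 * sin (\<theta> t) - p2 * cos (\<theta> t))"
    "p1 \<noteq> 0 \<or> p2 \<noteq> 0 \<or> (\<forall>t. \<psi> t \<noteq> 0)"
    "AE t in lebesgue. t \<in> {0..T} \<longrightarrow> \<psi> t * u t = a * \<bar>\<psi> t\<bar>"
proof -
  have u: "bounded_meas T a u" and p: "primitive T \<theta> u" "primitive T x (\<lambda>t. cos (\<theta> t))" "primitive T y (\<lambda>t. sin (\<theta> t))"
    using c by (simp_all add: curvature_curve_def)
  obtain n where n: "n \<noteq> 0" "\<And>b w. b < a \<Longrightarrow> bounded_meas T b w \<Longrightarrow>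
      n \<bullet> endpoint_variation T \<theta> w \<le> n \<bullet> endpoint_variation T \<theta> u"
    using separation_from_smaller_controls[OF T a u p(1) min] by blast
  obtain c p1 p2 where cp: "n = (c, p1, p2)" by (cases n rule: prod_cases3)
  define \<psi> where "\<psi> t = (c + (- p1) * y T + p2 * x T) + (p1 * y t + (- p2) * x t)" for t
  have \<psi>': "primitive T \<psi> (\<lambda>t. 0 + (p1 * sin (\<theta> t) + (- p2) * cos (\<theta> t)))"
    unfolding \<psi>_def by (intro primitive_add primitive_const primitive_cmult p)
  then have \<psi>: "primitive T \<psi> (\<lambda>t. p1 * sin (\<theta> t) - p2 * cos (\<theta> t))" by simp
  have \<psi>T: "\<psi> T = c" by (simp add: \<psi>_def)
  note mom = endpoint_variation_moment[OF \<psi> primitive_continuous[OF p(1)] _ less_imp_le[OF T], unfolded \<psi>T]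
  have "AE t in lebesgue. t \<in> {0..T} \<longrightarrow> \<psi> t * u t = a * \<bar>\<psi> t\<bar>"
  proof (rule saturated_control[OF _ _ u primitive_continuous[OF \<psi>]])
    fix b w assume b: "b < a" and w: "bounded_meas T b w"
    show "integral {0..T} (\<lambda>t. \<psi> t * w t) \<le> integral {0..T} (\<lambda>t. \<psi> t * u t)"
      using n(2)[OF b w] by (simp only: cp mom[OF w] mom[OF u])
  qed (use T a in auto)
  moreover have "p1 \<noteq> 0 \<or> p2 \<noteq> 0 \<or> (\<forall>t. \<psi> t \<noteq> 0)"
    using n(1) by (auto simp: cp zero_prod_def \<psi>_def)
  ultimately show thesis using that[OF \<psi>] by blast
qed

section \<open>Vanishing almost everywhere\<close>

lemma integral_tendsto_dominated:
  assumes f: "\<And>n. bounded_meas T C (f n)" and g: "bounded_meas T D g"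
    and lim: "AE t in lebesgue. t \<in> {0..T} \<longrightarrow> (\<lambda>n. f n t) \<longlonglongrightarrow> g t"
  shows "(\<lambda>n. integral {0..T} (f n)) \<longlonglongrightarrow> integral {0..T} g"
proof -
  have F: "has_bochner_integral (lebesgue_on {0<..<T}) (f n) (integral {0..T} (f n))" for n
    by (rule bounded_meas_has_bochner_integral[OF f])
  have G: "has_bochner_integral (lebesgue_on {0<..<T}) g (integral {0..T} g)"
    by (rule bounded_meas_has_bochner_integral[OF g])
  have "(\<lambda>n. LINT t|lebesgue_on {0<..<T}. f n t) \<longlonglongrightarrow> (LINT t|lebesgue_on {0<..<T}. g t)"
  proof (rule integral_dominated_convergence[where w = "\<lambda>_. C"])
    show "g \<in> borel_measurable (lebesgue_on {0<..<T})" "f n \<in> borel_measurable (lebesgue_on {0<..<T})" for n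
      using F[of n] G by (auto simp: has_bochner_integral_iff)
    show "integrable (lebesgue_on {0<..<T}) (\<lambda>_. C)"
      using bounded_meas_has_bochner_integral[of T "\<bar>C\<bar>" "\<lambda>_. C"]
      by (auto simp: has_bochner_integral_iff bounded_meas_def)
    show "AE t in lebesgue_on {0<..<T}. (\<lambda>n. f n t) \<longlonglongrightarrow> g t"
      unfolding AE_lebesgue_on_iff[OF lmeasurable_interval(2)[THEN fmeasurableD]]
      using lim by (auto elim!: eventually_mono)
    show "AE t in lebesgue_on {0<..<T}. norm (f n t) \<le> C" for n
      using f[of n] by (intro AE_I2) (auto simp: bounded_meas_def)
  qed
  then show ?thesis using F G by (simp add: has_bochner_integral_iff)
qed

text \<open>
  By the product rule \<open>u\<close> is orthogonal to all polynomials, by Weierstrass to all continuous functions,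
  and by dominated convergence to itself.
\<close>
lemma AE_zero_if_integrals_zero:
  assumes u: "bounded_meas T C u" and zero: "\<And>t. t \<in> {0..T} \<Longrightarrow> integral {0..t} u = 0" and T: "0 \<le> T"
  shows "AE t in lebesgue. t \<in> {0..T} \<longrightarrow> u t = 0"
proof -
  have C0: "0 \<le> C" using u T unfolding bounded_meas_def by force
  have pz: "primitive T (\<lambda>_. 0) u" using u zero by (auto simp: primitive_def)
  have poly: "integral {0..T} (\<lambda>t. u t * p t) = 0" if p: "real_polynomial_function p" for p :: "real \<Rightarrow> real"
  proof -
    obtain p' where p': "real_polynomial_function p'" "\<And>x. (p has_real_derivative p' x) (at x)"
      using has_real_derivative_polynomial_function[OF p] by blast
    have "continuous_on UNIV p'"
      using continuous_real_polymonial_function[OF p'(1)] by (simp add: continuous_at_imp_continuous_on)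
    from primitive_diff[OF primitive_mult[OF pz primitive_C1[OF p'(2) this]], of 0 T] T
    show ?thesis by simp
  qed
  have cont: "integral {0..T} (\<lambda>t. u t * k t) = 0" if k: "continuous_on {0..T} k" for k :: "real \<Rightarrow> real"
  proof (rule ccontr)
    let ?J = "integral {0..T} (\<lambda>t. u t * k t)"
    assume "?J \<noteq> 0"
    define e where "e = \<bar>?J\<bar> / (2 * (C * T + 1))"
    have CT: "0 \<le> C * T" using C0 T by simp
    then have e: "0 < e" using \<open>?J \<noteq> 0\<close> by (simp add: e_def)
    obtain p where p: "real_polynomial_function p" "\<And>t. t \<in> {0..T} \<Longrightarrow> \<bar>k t - p t\<bar> < e"
      using Stone_Weierstrass_real_polynomial_function[OF compact_Icc k e] by blast
    have pc: "continuous_on {0..T} p"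
      using continuous_real_polymonial_function[OF p(1)] by (simp add: continuous_at_imp_continuous_on)
    obtain K1 K2 where K: "bounded_meas T K1 k" "bounded_meas T K2 p"
      using bounded_meas_continuous[OF k] bounded_meas_continuous[OF pc] by metis
    have "?J = integral {0..T} (\<lambda>t. u t * k t) - integral {0..T} (\<lambda>t. u t * p t)" using poly[OF p(1)] by simp
    also have "\<dots> = integral {0..T} (\<lambda>t. u t * k t - u t * p t)"
      by (intro integral_diff[symmetric] bounded_meas_integrable[OF bounded_meas_mult[OF u K(1)]]
          bounded_meas_integrable[OF bounded_meas_mult[OF u K(2)]]) auto
    also have "norm \<dots> \<le> integral {0..T} (\<lambda>_. C * e)"
    proof (rule integral_norm_bound_integral)
      show "(\<lambda>t. u t * k t - u t * p t) integrable_on {0..T}"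
        by (intro integrable_diff bounded_meas_integrable[OF bounded_meas_mult[OF u K(1)]]
          bounded_meas_integrable[OF bounded_meas_mult[OF u K(2)]]) auto
      show "norm (u t * k t - u t * p t) \<le> C * e" if "t \<in> {0..T}" for t
        using u p(2)[OF that] that C0 unfolding right_diff_distrib[symmetric] real_norm_def abs_mult bounded_meas_def
        by (intro mult_mono) auto
    qed (simp add: integrable_const_ivl)
    finally have "\<bar>?J\<bar> \<le> e * (C * T)" using T by (simp add: mult_ac)
    also have "\<dots> < e * (2 * (C * T + 1))" using e CT by (intro mult_strict_left_mono) auto
    also have "\<dots> = \<bar>?J\<bar>" using CT by (simp add: e_def)
    finally show False by simp
  qed
  define u0 where "u0 t = (if t \<in> {0..T} then u t else 0)" for t
  have "u0 \<in> borel_measurable lebesgue"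
    unfolding u0_def using u by (intro borel_measurable_if_I) (auto simp: bounded_meas_def)
  then have "u0 measurable_on UNIV" by (rule lebesgue_measurable_imp_measurable_on_real) simp
  then obtain N g where N: "negligible N" and g: "\<And>n. continuous_on UNIV (g n)"
    and lim: "\<And>t. t \<notin> N \<Longrightarrow> (\<lambda>n. g n t) \<longlonglongrightarrow> u0 t"
    unfolding measurable_on_def by auto
  \<comment> \<open>truncation at the bound of \<open>u\<close> provides domination and does not affect the limit\<close>
  define k where "k n t = max (- C) (min C (g n t))" for n :: nat and t
  have kc: "continuous_on {0..T} (k n)" for n
    unfolding k_def by (intro continuous_intros continuous_on_subset[OF g]) auto
  have kb: "bounded_meas T C (k n)" for n
    unfolding bounded_meas_def
  proof (intro conjI ballI)
    show "k n \<in> borel_measurable (lebesgue_on {0..T})"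
      by (rule continuous_imp_measurable_on_sets_lebesgue[OF kc]) auto
    show "\<bar>k n t\<bar> \<le> C" for t using C0 by (auto simp: k_def)
  qed
  have "(\<lambda>n. integral {0..T} (\<lambda>t. u t * k n t)) \<longlonglongrightarrow> integral {0..T} (\<lambda>t. u t * u t)"
  proof (rule integral_tendsto_dominated[OF bounded_meas_mult[OF u kb] bounded_meas_mult[OF u u]])
    have "(\<lambda>n. u t * k n t) \<longlonglongrightarrow> u t * u t" if "t \<notin> N" "t \<in> {0..T}" for t
    proof -
      have "(\<lambda>n. k n t) \<longlonglongrightarrow> max (- C) (min C (u0 t))"
        unfolding k_def by (intro tendsto_intros lim that)
      moreover have "\<bar>u t\<bar> \<le> C" using u that by (simp add: bounded_meas_def)
      then have "max (- C) (min C (u0 t)) = u t" using that by (auto simp: u0_def)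
      ultimately show ?thesis by (intro tendsto_intros) simp
    qed
    then show "AE t in lebesgue. t \<in> {0..T} \<longrightarrow> (\<lambda>n. u t * k n t) \<longlonglongrightarrow> u t * u t"
      unfolding eventually_ae_filter_negligible using N by (intro exI[of _ N]) auto
  qed
  then have "integral {0..T} (\<lambda>t. u t * u t) = 0"
    using cont[OF kc] by (simp add: LIMSEQ_const_iff)
  then have "AE t in lebesgue. t \<in> {0..T} \<longrightarrow> u t * u t = 0"
    by (intro AE_zero_if_integral_nonpos[OF bounded_meas_mult[OF u u]]) auto
  then show ?thesis by (rule eventually_mono) auto
qed

text \<open>
  Cutting \<open>u\<close> off outside \<open>[s,t]\<close> leaves a function all of whose integrals from \<open>0\<close> vanish.
\<close>
lemma AE_zero_if_primitive_constant:
  assumes \<theta>: "primitive T \<theta> u" and st: "0 \<le> s" "s \<le> t" "t \<le> T"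
    and const: "\<And>r. r \<in> {s..t} \<Longrightarrow> \<theta> r = k"
  shows "AE r in lebesgue. r \<in> {s..t} \<longrightarrow> u r = 0"
proof -
  obtain C where u: "bounded_meas T C u" using \<theta> by (auto simp: primitive_def)
  define w where "w r = u r * (if s \<le> r \<and> r \<le> t then 1 else 0)" for r
  have w: "bounded_meas T (C * 1) w"
    unfolding w_def
  proof (rule bounded_meas_mult[OF u])
    have "(\<lambda>r. if s \<le> r \<and> r \<le> t then 1 else 0 :: real) \<in> borel_measurable lborel" by measurable
    then have "(\<lambda>r. if s \<le> r \<and> r \<le> t then 1 else 0 :: real) \<in> borel_measurable lebesgue"
      by (rule measurable_completion)
    then show "bounded_meas T 1 (\<lambda>r. if s \<le> r \<and> r \<le> t then 1 else 0)"
      unfolding bounded_meas_def by (auto intro: measurable_restrict_space1)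
  qed
  have "integral {0..r} w = 0" if r: "r \<in> {0..T}" for r
  proof -
    have "integral {0..r} w = integral {0..r} (\<lambda>r. if r \<in> {s..t} then u r else 0)"
      by (intro integral_cong) (simp add: w_def)
    also have "\<dots> = integral ({s..t} \<inter> {0..r}) u"
      by (rule Henstock_Kurzweil_Integration.integral_restrict_Int)
    also have "{s..t} \<inter> {0..r} = {s..min t r}" using st by auto
    also have "integral {s..min t r} u = 0"
    proof (cases "s \<le> min t r")
      case True
      then show ?thesis using primitive_diff[OF \<theta>, of s "min t r"] const[of s] const[of "min t r"] st r by auto
    qed simp
    finally show ?thesis .
  qed
  then have "AE r in lebesgue. r \<in> {0..T} \<longrightarrow> w r = 0"
    using st by (intro AE_zero_if_integrals_zero[OF w]) auto
  then show ?thesis by (rule eventually_mono) (use st in \<open>auto simp: w_def\<close>)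
qed

section \<open>Conservation of energy\<close>

lemma bounded_meas_restrict:
  "bounded_meas T C g \<Longrightarrow> t \<le> T \<Longrightarrow> bounded_meas t C g"
  unfolding bounded_meas_def by (auto intro: measurable_restrict_mono)

lemma primitive_has_derivative:
  assumes f: "primitive T f g" and g: "continuous_on {0..T} g" and t: "t \<in> {0..T}"
  shows "(f has_real_derivative g t) (at t within {0..T})"
proof -
  have "((\<lambda>t. f 0 + integral {0..t} g) has_real_derivative 0 + g t) (at t within {0..T})"
    by (intro derivative_intros integral_has_real_derivative g t)
  then have "((\<lambda>t. f 0 + integral {0..t} g) has_real_derivative g t) (at t within {0..T})" by simp
  then show ?thesis
  proof (rule has_field_derivative_transform_within[where d = 1])
    fix r assume "r \<in> {0..T}"
    then have "f r - f 0 = integral {0..r} g" using f by (auto simp: primitive_def)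
    then show "f 0 + integral {0..r} g = f r" by linarith
  qed (use t in auto)
qed

text \<open>
  Where the derivative is invertible the preimage of a null set is null.
\<close>
lemma AE_derivative_zero_on_zero_set:
  assumes f: "primitive T f g" and g: "continuous_on {0..T} g"
  shows "AE t in lebesgue. t \<in> {0..T} \<longrightarrow> f t = 0 \<longrightarrow> g t = 0"
proof -
  let ?S = "{t \<in> {0..T}. g t \<noteq> 0}"
  have "negligible {t \<in> ?S. f t \<in> {0}}"
  proof (rule negligible_differentiable_vimage)
    show "(f has_derivative (*) (g t)) (at t within ?S)" if "t \<in> ?S" for t
      using primitive_has_derivative[OF f g, of t] that
      by (auto simp: has_field_derivative_def intro: has_derivative_subset)
    show "inj ((*) (g t))" if "t \<in> ?S" for t
      using that by (auto simp: inj_on_def)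
  qed simp
  then show ?thesis
    unfolding eventually_ae_filter_negligible by (rule exI[where x = "{t \<in> ?S. f t \<in> {0}}", OF conjI]) auto
qed

text \<open>
  As \<open>e\<close> tends to \<open>0\<close> this smoothing of the absolute value carries the chain rule over to \<open>primitive_abs\<close>.
\<close>
lemma smooth_abs:
  fixes e :: real
  assumes e: "0 < e"
  shows "((\<lambda>x. sqrt (x\<^sup>2 + e\<^sup>2)) has_real_derivative x / sqrt (x\<^sup>2 + e\<^sup>2)) (at x)"
    and "\<bar>x / sqrt (x\<^sup>2 + e\<^sup>2) - y / sqrt (y\<^sup>2 + e\<^sup>2)\<bar> \<le> (1 / e) * \<bar>x - y\<bar>"
    and "\<bar>x / sqrt (x\<^sup>2 + e\<^sup>2)\<bar> \<le> 1"
proof -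
  have pos: "0 < x\<^sup>2 + e\<^sup>2" for x using e by (simp add: add_nonneg_pos)
  show "((\<lambda>x. sqrt (x\<^sup>2 + e\<^sup>2)) has_real_derivative x / sqrt (x\<^sup>2 + e\<^sup>2)) (at x)"
    using pos[of x] by (auto intro!: derivative_eq_intros simp: field_simps)
  show "\<bar>x / sqrt (x\<^sup>2 + e\<^sup>2)\<bar> \<le> 1"
    using pos[of x] by (simp add: abs_divide real_le_rsqrt)
  have "norm (x / sqrt (x\<^sup>2 + e\<^sup>2) - y / sqrt (y\<^sup>2 + e\<^sup>2)) \<le> (1 / e) * norm (x - y)"
  proof (rule field_differentiable_bound[of UNIV "\<lambda>x. x / sqrt (x\<^sup>2 + e\<^sup>2)" "\<lambda>x. e\<^sup>2 / ((x\<^sup>2 + e\<^sup>2) * sqrt (x\<^sup>2 + e\<^sup>2))"])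
    fix z :: real
    let ?s = "sqrt (z\<^sup>2 + e\<^sup>2)"
    have s: "0 < ?s" "?s * ?s = z\<^sup>2 + e\<^sup>2" using pos[of z] by auto
    have "((\<lambda>x. x / sqrt (x\<^sup>2 + e\<^sup>2)) has_real_derivative (1 * ?s - z * (z / ?s)) / (?s * ?s)) (at z)"
      using pos[of z] by (auto intro!: derivative_eq_intros simp: field_simps)
    moreover have "(1 * r - z * (z / r)) / (r * r) = (r * r - z\<^sup>2) / (r * r * r)" if "0 < r" for r
      using that by (simp add: field_simps power2_eq_square)
    note this[OF s(1)]
    moreover have "(?s * ?s - z\<^sup>2) / (?s * ?s * ?s) = e\<^sup>2 / ((z\<^sup>2 + e\<^sup>2) * ?s)" unfolding s(2) by simp
    ultimately show "((\<lambda>x. x / sqrt (x\<^sup>2 + e\<^sup>2)) has_field_derivative e\<^sup>2 / ((z\<^sup>2 + e\<^sup>2) * ?s)) (at z within UNIV)"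
      by simp
    have es: "e \<le> ?s" by (rule real_le_rsqrt) simp
    have "e\<^sup>2 * e \<le> (z\<^sup>2 + e\<^sup>2) * ?s" using es e by (intro mult_mono) auto
    then have "e\<^sup>2 / ((z\<^sup>2 + e\<^sup>2) * ?s) \<le> 1 / e"
      using pos[of z] s(1) e by (simp add: divide_le_eq le_divide_eq mult_ac)
    then show "norm (e\<^sup>2 / ((z\<^sup>2 + e\<^sup>2) * ?s)) \<le> 1 / e" using pos[of z] by (simp add: less_imp_le)
  qed auto
  then show "\<bar>x / sqrt (x\<^sup>2 + e\<^sup>2) - y / sqrt (y\<^sup>2 + e\<^sup>2)\<bar> \<le> (1 / e) * \<bar>x - y\<bar>" by simp
qed

text \<open>
  The convergence of the smoothed derivatives holds at every point, zeros of \<open>f\<close> included, because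
  \<open>sgn 0 = 0\<close>.
\<close>
lemma primitive_abs:
  assumes f: "primitive T f g" and g: "continuous_on {0..T} g"
  shows "primitive T (\<lambda>t. \<bar>f t\<bar>) (\<lambda>t. sgn (f t) * g t)"
proof -
  obtain C where C: "bounded_meas T C g" using f by (auto simp: primitive_def)
  note fc = primitive_continuous[OF f]
  have sgn: "bounded_meas T 1 (\<lambda>t. sgn (f t))"
    unfolding bounded_meas_def
  proof (intro conjI ballI)
    have [measurable]: "f \<in> borel_measurable (lebesgue_on {0..T})"
      by (rule continuous_imp_measurable_on_sets_lebesgue[OF fc]) auto
    show "(\<lambda>t. sgn (f t)) \<in> borel_measurable (lebesgue_on {0..T})"
      unfolding sgn_if by measurable
    show "\<bar>sgn (f t)\<bar> \<le> 1" for t by (simp add: abs_sgn_eq)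
  qed
  have sg: "bounded_meas T (1 * C) (\<lambda>t. sgn (f t) * g t)" by (rule bounded_meas_mult[OF sgn C])
  have "\<bar>f t\<bar> - \<bar>f 0\<bar> = integral {0..t} (\<lambda>t. sgn (f t) * g t)" if t: "t \<in> {0..T}" for t
  proof -
    define e where "e n = 1 / real (Suc n)" for n
    have e: "0 < e n" for n by (simp add: e_def)
    have e0: "e \<longlonglongrightarrow> 0" unfolding e_def by (rule LIMSEQ_Suc[OF lim_1_over_n])
    define s where "s n t = f t / sqrt ((f t)\<^sup>2 + (e n)\<^sup>2)" for n t
    have S: "primitive T (\<lambda>t. sqrt ((f t)\<^sup>2 + (e n)\<^sup>2)) (\<lambda>t. s n t * g t)" for n
      unfolding s_def
      by (rule primitive_compose[OF f, where F = "\<lambda>x. sqrt (x\<^sup>2 + (e n)\<^sup>2)" and F' = "\<lambda>x. x / sqrt (x\<^sup>2 + (e n)\<^sup>2)"])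
        (rule smooth_abs[OF e])+
    have eq: "sqrt ((f t)\<^sup>2 + (e n)\<^sup>2) - sqrt ((f 0)\<^sup>2 + (e n)\<^sup>2) = integral {0..t} (\<lambda>t. s n t * g t)" for n
      using primitive_diff[OF S, of 0 t n] t by simp
    have sc: "continuous_on {0..t} (s n)" for n
    proof -
      have "(f r)\<^sup>2 + (e n)\<^sup>2 \<noteq> 0" for r using e[of n] by (simp add: add_nonneg_eq_0_iff)
      then show ?thesis unfolding s_def
        using t by (intro continuous_intros continuous_on_subset[OF fc]) auto
    qed
    have sb: "bounded_meas t (1 * C) (\<lambda>t. s n t * g t)" for n
    proof (rule bounded_meas_mult)
      show "bounded_meas t C g" using bounded_meas_restrict[OF C] t by simp
      show "bounded_meas t 1 (s n)" unfolding bounded_meas_def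
        using smooth_abs(3)[OF e] by (auto simp: s_def intro: continuous_imp_measurable_on_sets_lebesgue[OF sc])
    qed
    have "(\<lambda>n. integral {0..t} (\<lambda>t. s n t * g t)) \<longlonglongrightarrow> integral {0..t} (\<lambda>t. sgn (f t) * g t)"
    proof (rule integral_tendsto_dominated[OF sb])
      show "bounded_meas t (1 * C) (\<lambda>t. sgn (f t) * g t)" using bounded_meas_restrict[OF sg] t by simp
      have "(\<lambda>n. s n r * g r) \<longlonglongrightarrow> sgn (f r) * g r" for r
      proof (cases "f r = 0")
        case False
        have "(\<lambda>n. s n r * g r) \<longlonglongrightarrow> f r / sqrt ((f r)\<^sup>2 + 0\<^sup>2) * g r"
          unfolding s_def using False by (intro tendsto_intros e0) auto
        moreover have "f r / sqrt ((f r)\<^sup>2 + 0\<^sup>2) = sgn (f r)"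
          using False by (simp add: sgn_if)
        ultimately show ?thesis by (simp only:)
      qed (simp add: s_def)
      then show "AE r in lebesgue. r \<in> {0..t} \<longrightarrow> (\<lambda>n. s n r * g r) \<longlonglongrightarrow> sgn (f r) * g r" by simp
    qed
    moreover have "(\<lambda>n. sqrt ((f t)\<^sup>2 + (e n)\<^sup>2) - sqrt ((f 0)\<^sup>2 + (e n)\<^sup>2)) \<longlonglongrightarrow> sqrt ((f t)\<^sup>2 + 0\<^sup>2) - sqrt ((f 0)\<^sup>2 + 0\<^sup>2)"
      by (intro tendsto_intros e0)
    ultimately have "sqrt ((f t)\<^sup>2 + 0\<^sup>2) - sqrt ((f 0)\<^sup>2 + 0\<^sup>2) = integral {0..t} (\<lambda>t. sgn (f t) * g t)"
      unfolding eq by (rule LIMSEQ_unique[rotated])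
    then show ?thesis by simp
  qed
  then show ?thesis using sg unfolding primitive_def by blast
qed

text \<open>
  A curvature \<open>u\<close> that satisfies the maximum principle with the multiplier \<open>(p1, p2)\<close> and the switching
  function \<open>\<psi>\<close>.
\<close>
locale extremal =
  fixes T a p1 p2 :: real and u \<theta> \<psi> :: "real \<Rightarrow> real"
  assumes a: "0 < a"
    and \<theta>: "primitive T \<theta> u"
    and \<psi>: "primitive T \<psi> (\<lambda>t. p1 * sin (\<theta> t) - p2 * cos (\<theta> t))"
    and nontrivial: "p1 \<noteq> 0 \<or> p2 \<noteq> 0 \<or> (\<forall>t. \<psi> t \<noteq> 0)"
    and saturated: "AE t in lebesgue. t \<in> {0..T} \<longrightarrow> \<psi> t * u t = a * \<bar>\<psi> t\<bar>"
begin

abbreviation d\<psi> :: "real \<Rightarrow> real" where "d\<psi> t \<equiv> p1 * sin (\<theta> t) - p2 * cos (\<theta> t)"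

text \<open>
  Up to the factor \<open>u\<close> this is the second derivative of \<open>\<psi>\<close>; it is also the component of the
  velocity along the switching line, scaled by the length of \<open>(p1, p2)\<close>.
\<close>
abbreviation d2\<psi> :: "real \<Rightarrow> real" where "d2\<psi> t \<equiv> p1 * cos (\<theta> t) + p2 * sin (\<theta> t)"

lemma d\<psi>_continuous: "continuous_on {0..T} d\<psi>"
  by (intro continuous_intros primitive_continuous[OF \<theta>])

text \<open>
  The derivative of \<open>d2\<psi>\<close> is \<open>- u d\<psi>\<close> and that of \<open>a \<bar>\<psi>\<bar>\<close> is \<open>a (sgn \<psi>) d\<psi>\<close>.  They cancel where
  \<open>\<psi> \<noteq> 0\<close> by the maximum principle, and almost everywhere on the zero set of \<open>\<psi>\<close> since \<open>d\<psi>\<close> vanishes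
  there.
\<close>
lemma energy_conserved:
  assumes t: "t \<in> {0..T}"
  shows "d2\<psi> t + a * \<bar>\<psi> t\<bar> = d2\<psi> 0 + a * \<bar>\<psi> 0\<bar>"
proof -
  have "primitive T (\<lambda>t. (p1 * cos (\<theta> t) + p2 * sin (\<theta> t)) + a * \<bar>\<psi> t\<bar>)
      (\<lambda>t. (p1 * (- sin (\<theta> t) * u t) + p2 * (cos (\<theta> t) * u t)) + a * (sgn (\<psi> t) * d\<psi> t))"
    by (intro primitive_add primitive_cmult primitive_cos primitive_sin \<theta> primitive_abs \<psi> d\<psi>_continuous)
  then have "(d2\<psi> t + a * \<bar>\<psi> t\<bar>) - (d2\<psi> 0 + a * \<bar>\<psi> 0\<bar>)
      = integral {0..t} (\<lambda>t. (p1 * (- sin (\<theta> t) * u t) + p2 * (cos (\<theta> t) * u t)) + a * (sgn (\<psi> t) * d\<psi> t))"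
    using t by (auto simp: primitive_def)
  also have "\<dots> = integral {0..t} (\<lambda>t. 0)"
  proof (rule integral_cong_AE_lebesgue)
    show "AE r in lebesgue. r \<in> {0..t} \<longrightarrow>
       (p1 * (- sin (\<theta> r) * u r) + p2 * (cos (\<theta> r) * u r)) + a * (sgn (\<psi> r) * d\<psi> r) = 0"
      using saturated AE_derivative_zero_on_zero_set[OF \<psi> d\<psi>_continuous]
    proof eventually_elim
      case (elim r)
      show ?case
      proof
        assume "r \<in> {0..t}"
        then have r: "r \<in> {0..T}" using t by auto
        have "(u r - a * sgn (\<psi> r)) * d\<psi> r = 0"
        proof (cases "\<psi> r = 0")
          case False
          have "\<psi> r * (u r - a * sgn (\<psi> r)) = 0"
            using elim(1) r by (simp add: right_diff_distrib abs_sgn mult_ac)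
          then show ?thesis using False by simp
        qed (use elim(2) r in simp)
        then show "(p1 * (- sin (\<theta> r) * u r) + p2 * (cos (\<theta> r) * u r)) + a * (sgn (\<psi> r) * d\<psi> r) = 0"
          by (simp add: algebra_simps)
      qed
    qed
  qed
  finally show ?thesis by simp
qed

end

section \<open>Bang and singular arcs\<close>

definition constant_arc :: "(real \<Rightarrow> real) \<Rightarrow> real \<Rightarrow> real \<Rightarrow> bool" where
  "constant_arc v s t \<longleftrightarrow> (\<exists>c\<in>{1, -1, 0}. AE r in lebesgue. r \<in> {s<..<t} \<longrightarrow> v r = c)"

lemma constant_arc_mono: "constant_arc v s t \<Longrightarrow> s \<le> s' \<Longrightarrow> t' \<le> t \<Longrightarrow> constant_arc v s' t'"
  unfolding constant_arc_def by (elim bexE, rule bexI, erule eventually_mono) auto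

lemma small_angle_zero:
  fixes \<delta> :: real
  assumes "sin \<delta> = 0" "\<bar>\<delta>\<bar> < pi"
  shows "\<delta> = 0"
  using assms sin_gt_zero[of \<delta>] sin_gt_zero[of "- \<delta>"] by (cases \<delta> "0::real" rule: linorder_cases) auto

context extremal
begin

lemma arc_if_nonzero:
  assumes st: "0 \<le> s" "t \<le> T" and nz: "\<And>r. r \<in> {s<..<t} \<Longrightarrow> \<psi> r \<noteq> 0"
  shows "constant_arc (\<lambda>r. u r / a) s t"
proof -
  have c: "continuous_on {s<..<t} \<psi>"
    using primitive_continuous[OF \<psi>] by (rule continuous_on_subset) (use st in auto)
  have conn: "connected (\<psi> ` {s<..<t})" by (intro connected_continuous_image c connected_Ioo)
  have sgn: "(\<forall>r\<in>{s<..<t}. 0 < \<psi> r) \<or> (\<forall>r\<in>{s<..<t}. \<psi> r < 0)"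
  proof (rule ccontr)
    assume "\<not> ?thesis"
    then obtain p q where pq: "p \<in> {s<..<t}" "q \<in> {s<..<t}" "\<psi> p \<le> 0" "0 \<le> \<psi> q" by (auto simp: not_less)
    have "0 \<in> \<psi> ` {s<..<t}"
      using connectedD_interval[OF conn imageI[OF pq(1)] imageI[OF pq(2)] pq(3,4)] .
    then show False using nz by auto
  qed
  have "AE r in lebesgue. r \<in> {s<..<t} \<longrightarrow> u r / a = sgn (\<psi> r)"
    using saturated
  proof (rule eventually_mono, intro impI)
    fix r assume "r \<in> {0..T} \<longrightarrow> \<psi> r * u r = a * \<bar>\<psi> r\<bar>" and r: "r \<in> {s<..<t}"
    then have "\<psi> r * u r = \<psi> r * (a * sgn (\<psi> r))" using st by (simp add: abs_sgn mult_ac)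
    then show "u r / a = sgn (\<psi> r)" using nz[OF r] a by simp
  qed
  moreover define c :: real where "c = (if \<forall>r\<in>{s<..<t}. 0 < \<psi> r then 1 else -1)"
  ultimately have "AE r in lebesgue. r \<in> {s<..<t} \<longrightarrow> u r / a = c"
    by (elim eventually_mono) (use sgn in \<open>auto simp: c_def\<close>)
  moreover have "c \<in> {1, -1, 0}" by (auto simp: c_def)
  ultimately show ?thesis unfolding constant_arc_def by blast
qed

text \<open>
  \<open>(d2\<psi>, d\<psi>)\<close> is a fixed vector turned by the direction angle.
\<close>
lemma rotation_about_critical:
  assumes "d\<psi> x = 0"
  shows "d\<psi> t = d2\<psi> x * sin (\<theta> t - \<theta> x)" "d2\<psi> t = d2\<psi> x * cos (\<theta> t - \<theta> x)"
proof -
  define \<delta> where "\<delta> = \<theta> t - \<theta> x"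
  have t: "\<theta> t = \<theta> x + \<delta>" by (simp add: \<delta>_def)
  have "d\<psi> t = d\<psi> x * cos \<delta> + d2\<psi> x * sin \<delta>" "d2\<psi> t = d2\<psi> x * cos \<delta> - d\<psi> x * sin \<delta>"
    unfolding t sin_add cos_add by (simp_all add: algebra_simps)
  then show "d\<psi> t = d2\<psi> x * sin (\<theta> t - \<theta> x)" "d2\<psi> t = d2\<psi> x * cos (\<theta> t - \<theta> x)"
    using assms by (simp_all add: \<delta>_def)
qed

lemma d2\<psi>_nonzero:
  assumes "\<psi> x = 0" "d\<psi> x = 0"
  shows "d2\<psi> x \<noteq> 0"
proof
  assume "d2\<psi> x = 0"
  have "p1\<^sup>2 + p2\<^sup>2 = (p1\<^sup>2 + p2\<^sup>2) * ((sin (\<theta> x))\<^sup>2 + (cos (\<theta> x))\<^sup>2)" by simp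
  also have "\<dots> = (d\<psi> x)\<^sup>2 + (d2\<psi> x)\<^sup>2" by (simp add: power2_eq_square algebra_simps del: sin_cos_squared_add sin_cos_squared_add2 sin_cos_squared_add3)
  finally have "p1\<^sup>2 + p2\<^sup>2 = 0" using assms \<open>d2\<psi> x = 0\<close> by simp
  then show False using nontrivial assms(1) by (auto simp: sum_power2_eq_zero_iff)
qed

text \<open>
  The window \<open>\<bar>\<theta> t - \<theta> x\<bar> < \<pi>\<close> keeps the opposite and the once-turned direction away, so that
  \<open>d\<psi> t = 0\<close> as well as \<open>d2\<psi> t = d2\<psi> x\<close> mean \<open>\<theta> t = \<theta> x\<close>.  Energy conservation then compares
  \<open>\<psi> t\<close> with \<open>\<psi> x = 0\<close>.
\<close>
lemma near_degenerate_zero: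
  assumes x: "x \<in> {0..T}" "\<psi> x = 0" "d\<psi> x = 0" and t: "t \<in> {0..T}" "\<bar>\<theta> t - \<theta> x\<bar> < pi"
  shows "d\<psi> t = 0 \<Longrightarrow> \<psi> t = 0" and "\<psi> t = 0 \<Longrightarrow> \<theta> t = \<theta> x"
proof -
  have E: "d2\<psi> t + a * \<bar>\<psi> t\<bar> = d2\<psi> x"
    using energy_conserved[OF x(1)] energy_conserved[OF t(1)] x(2) by simp
  note rot = rotation_about_critical[OF x(3), of t] and nz = d2\<psi>_nonzero[OF x(2,3)]
  show "\<psi> t = 0" if "d\<psi> t = 0"
  proof -
    have "sin (\<theta> t - \<theta> x) = 0" using rot(1) that nz by simp
    then have "\<theta> t = \<theta> x" using small_angle_zero t(2) by fastforce
    then have "a * \<bar>\<psi> t\<bar> = 0" using E by simp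
    then show ?thesis using a by simp
  qed
  show "\<theta> t = \<theta> x" if "\<psi> t = 0"
  proof -
    have "d2\<psi> x * cos (\<theta> t - \<theta> x) = d2\<psi> x" using E rot(2) that by simp
    then have "cos (\<theta> t - \<theta> x) = 1" using nz by simp
    then have "sin (\<theta> t - \<theta> x) = 0" by (rule cos_one_sin_zero)
    then show ?thesis using small_angle_zero t(2) by fastforce
  qed
qed

text \<open>
  Between two zeros of \<open>\<psi>\<close> near a tangency, \<open>\<psi>\<^sup>2\<close> has a maximum; there \<open>\<psi>\<close> is critical, hence zero.
  So \<open>\<psi>\<close> vanishes in between, the direction is constant, and so the curvature is zero.
\<close>
lemma singular_arc:
  assumes x: "x \<in> {0..T}" "\<psi> x = 0" "d\<psi> x = 0" and st: "0 \<le> s" "s < t" "t \<le> T"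
    and near: "\<And>r. r \<in> {s..t} \<Longrightarrow> \<bar>\<theta> r - \<theta> x\<bar> < pi" and ends: "\<psi> s = 0" "\<psi> t = 0"
  shows "constant_arc (\<lambda>r. u r / a) s t"
proof -
  have cont: "continuous_on {s..t} \<psi>"
    using primitive_continuous[OF \<psi>] by (rule continuous_on_subset) (use st in auto)
  have zero: "\<psi> r = 0" if r: "r \<in> {s..t}" for r
  proof (rule ccontr)
    assume "\<psi> r \<noteq> 0"
    obtain m where m: "m \<in> {s..t}" "\<And>q. q \<in> {s..t} \<Longrightarrow> (\<psi> q)\<^sup>2 \<le> (\<psi> m)\<^sup>2"
      using continuous_attains_sup[OF compact_Icc _ continuous_on_power[OF cont, of 2]] r by blast
    have "0 < (\<psi> r)\<^sup>2" using \<open>\<psi> r \<noteq> 0\<close> by simp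
    then have nz: "\<psi> m \<noteq> 0" using m(2)[OF r] by auto
    then have ms: "s < m" "m < t" using m(1) ends by (auto simp: order.order_iff_strict)
    have "(\<psi> has_real_derivative d\<psi> m) (at m within {0..T})"
      by (rule primitive_has_derivative[OF \<psi> d\<psi>_continuous]) (use m st in auto)
    then have "(\<psi> has_real_derivative d\<psi> m) (at m within {s<..<t})"
      by (rule has_field_derivative_subset) (use st in auto)
    then have "(\<psi> has_real_derivative d\<psi> m) (at m)"
      using ms by (simp add: at_within_open[of m "{s<..<t}"])
    then have "((\<lambda>q. (\<psi> q)\<^sup>2) has_real_derivative 2 * \<psi> m * d\<psi> m) (at m)"
      by (auto intro!: derivative_eq_intros)
    then have "2 * \<psi> m * d\<psi> m = 0"
    proof (rule DERIV_local_max)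
      show "0 < min (m - s) (t - m)" using ms by simp
      show "\<forall>q. \<bar>m - q\<bar> < min (m - s) (t - m) \<longrightarrow> (\<psi> q)\<^sup>2 \<le> (\<psi> m)\<^sup>2"
        by (intro allI impI m(2)) (auto simp: abs_less_iff)
    qed
    then have "d\<psi> m = 0" using nz by simp
    then have "\<psi> m = 0" using near_degenerate_zero(1)[OF x _ near[OF m(1)]] m(1) st by auto
    then show False using nz by simp
  qed
  have "\<theta> r = \<theta> x" if "r \<in> {s..t}" for r
    using near_degenerate_zero(2)[OF x _ near[OF that] zero[OF that]] that st by auto
  then have "AE r in lebesgue. r \<in> {s..t} \<longrightarrow> u r = 0"
    using st by (intro AE_zero_if_primitive_constant[OF \<theta>]) auto
  then have "AE r in lebesgue. r \<in> {s<..<t} \<longrightarrow> u r / a = 0"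
    by (rule eventually_mono) auto
  then show ?thesis unfolding constant_arc_def by (intro bexI[of _ 0]) auto
qed

text \<open>
  The first case also covers \<open>\<psi> x \<noteq> 0\<close>.
\<close>
lemma local_dichotomy:
  assumes x: "x \<in> {0..T}"
  obtains (isolated) d where "0 < d" "\<And>r. r \<in> {0..T} \<Longrightarrow> r \<noteq> x \<Longrightarrow> \<bar>r - x\<bar> < d \<Longrightarrow> \<psi> r \<noteq> 0"
  | (degenerate) d where "0 < d" "\<psi> x = 0" "d\<psi> x = 0"
      "\<And>r. r \<in> {0..T} \<Longrightarrow> \<bar>r - x\<bar> < d \<Longrightarrow> \<bar>\<theta> r - \<theta> x\<bar> < pi"
proof (cases "\<psi> x = 0 \<and> d\<psi> x = 0")
  case True
  obtain d where "0 < d" "\<forall>r\<in>{0..T}. dist r x < d \<longrightarrow> dist (\<theta> r) (\<theta> x) < pi"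
    using primitive_continuous[OF \<theta>] x pi_gt_zero unfolding continuous_on_iff by metis
  then show thesis using True by (intro degenerate[of d]) (auto simp: dist_real_def)
next
  case False
  have "\<forall>\<^sub>F r in at x within {0..T}. \<psi> r \<noteq> 0"
  proof (cases "\<psi> x = 0")
    case True
    then have "d\<psi> x \<noteq> 0" using False by simp
    moreover have "((\<lambda>r. (\<psi> r - \<psi> x) / (r - x)) \<longlongrightarrow> d\<psi> x) (at x within {0..T})"
      using primitive_has_derivative[OF \<psi> d\<psi>_continuous x] by (simp add: has_field_derivative_iff)
    ultimately have "\<forall>\<^sub>F r in at x within {0..T}. (\<psi> r - \<psi> x) / (r - x) \<noteq> 0"
      by (intro tendsto_imp_eventually_ne)
    then show ?thesis by (rule eventually_mono) (use True in auto)
  next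
    case False
    have "(\<psi> \<longlongrightarrow> \<psi> x) (at x within {0..T})"
      using primitive_continuous[OF \<psi>] x by (simp add: continuous_on_def)
    then show ?thesis using False by (intro tendsto_imp_eventually_ne)
  qed
  then obtain d where "0 < d" "\<forall>r\<in>{0..T}. r \<noteq> x \<and> dist r x < d \<longrightarrow> \<psi> r \<noteq> 0"
    unfolding eventually_at by auto
  then show thesis by (intro isolated[of d]) (auto simp: dist_real_def)
qed

text \<open>
  At a tangency either \<open>\<psi>\<close> has a further zero to the right, close to \<open>x\<close>, and a singular arc leads up
  to it, or \<open>\<psi>\<close> has no zero on a right neighbourhood.
\<close>
lemma arc_right:
  assumes x: "x \<in> {0..T}"
  obtains d where "0 < d" "\<And>t. x < t \<Longrightarrow> t < x + d \<Longrightarrow> t \<le> T \<Longrightarrow> constant_arc (\<lambda>r. u r / a) x t"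
  using x
proof (cases rule: local_dichotomy)
  case (isolated d)
  show thesis
    by (rule that[OF isolated(1)], rule arc_if_nonzero) (use x isolated(2) in auto)
next
  case (degenerate d)
  show thesis
  proof (cases "\<exists>y. x < y \<and> y < x + d \<and> y \<le> T \<and> \<psi> y = 0")
    case True
    then obtain y where y: "x < y" "y < x + d" "y \<le> T" "\<psi> y = 0" by auto
    have "constant_arc (\<lambda>r. u r / a) x y"
      by (rule singular_arc[OF x degenerate(2,3)]) (use x y degenerate in auto)
    then show thesis using y by (intro that[of "y - x"]) (auto intro: constant_arc_mono)
  next
    case False
    show thesis
      by (rule that[OF degenerate(1)], rule arc_if_nonzero) (use x False in auto)
  qed
qed

lemma arc_left:
  assumes x: "x \<in> {0..T}"
  obtains d where "0 < d" "\<And>s. s < x \<Longrightarrow> x - d < s \<Longrightarrow> 0 \<le> s \<Longrightarrow> constant_arc (\<lambda>r. u r / a) s x"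
  using x
proof (cases rule: local_dichotomy)
  case (isolated d)
  show thesis
    by (rule that[OF isolated(1)], rule arc_if_nonzero) (use x isolated(2) in auto)
next
  case (degenerate d)
  show thesis
  proof (cases "\<exists>y. y < x \<and> x - d < y \<and> 0 \<le> y \<and> \<psi> y = 0")
    case True
    then obtain y where y: "y < x" "x - d < y" "0 \<le> y" "\<psi> y = 0" by auto
    have "constant_arc (\<lambda>r. u r / a) y x"
      by (rule singular_arc[OF x degenerate(2,3)]) (use x y degenerate in auto)
    then show thesis using y by (intro that[of "x - y"]) (auto intro: constant_arc_mono)
  next
    case False
    show thesis
      by (rule that[OF degenerate(1)], rule arc_if_nonzero) (use x False in auto)
  qed
qed

end

section \<open>Finitely many arcs\<close>

definition finitely_many_arcs :: "(real \<Rightarrow> real) \<Rightarrow> real \<Rightarrow> real \<Rightarrow> bool" where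
  "finitely_many_arcs v s t \<longleftrightarrow>
     (\<exists>(n::nat) \<tau>. \<tau> 0 = s \<and> \<tau> n = t \<and> (\<forall>i<n. \<tau> i < \<tau> (Suc i) \<and> constant_arc v (\<tau> i) (\<tau> (Suc i))))"

lemma finitely_many_arcs_refl: "finitely_many_arcs v s s"
  unfolding finitely_many_arcs_def by (intro exI[of _ 0] exI[of _ "\<lambda>_. s"]) simp

lemma finitely_many_arcs_arc: "s < t \<Longrightarrow> constant_arc v s t \<Longrightarrow> finitely_many_arcs v s t"
  unfolding finitely_many_arcs_def
  by (intro exI[of _ "Suc 0"] exI[of _ "\<lambda>i. if i = 0 then s else t"]) simp

lemma finitely_many_arcs_trans:
  assumes "finitely_many_arcs v r s" "finitely_many_arcs v s t"
  shows "finitely_many_arcs v r t"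
proof -
  obtain m \<sigma> where \<sigma>: "\<sigma> 0 = r" "\<sigma> m = s" "\<And>i. i < m \<Longrightarrow> \<sigma> i < \<sigma> (Suc i) \<and> constant_arc v (\<sigma> i) (\<sigma> (Suc i))"
    using assms(1) unfolding finitely_many_arcs_def by blast
  obtain n \<tau> where \<tau>: "\<tau> 0 = s" "\<tau> n = t" "\<And>i. i < n \<Longrightarrow> \<tau> i < \<tau> (Suc i) \<and> constant_arc v (\<tau> i) (\<tau> (Suc i))"
    using assms(2) unfolding finitely_many_arcs_def by blast
  define \<rho> where "\<rho> i = (if i \<le> m then \<sigma> i else \<tau> (i - m))" for i
  have \<rho>\<tau>: "\<rho> i = \<tau> (i - m)" if "m \<le> i" for i
    using that \<sigma>(2) \<tau>(1) by (cases "i = m") (auto simp: \<rho>_def)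
  have "\<rho> i < \<rho> (Suc i) \<and> constant_arc v (\<rho> i) (\<rho> (Suc i))" if "i < m + n" for i
  proof (cases "i < m")
    case True
    then show ?thesis using \<sigma>(3) by (simp add: \<rho>_def)
  next
    case False
    then show ?thesis using \<tau>(3)[of "i - m"] that by (simp add: \<rho>\<tau> Suc_diff_le)
  qed
  moreover have "\<rho> 0 = r" "\<rho> (m + n) = t"
    using \<sigma>(1) \<tau>(2) \<rho>\<tau>[of "m + n"] by (auto simp: \<rho>_def)
  ultimately show ?thesis unfolding finitely_many_arcs_def by blast
qed

text \<open>
  One-sided constancy at every time, made global by the bisection principle of Bolzano.
\<close>
lemma (in extremal) finitely_many_arcs_extremal:
  assumes T: "0 \<le> T"
  shows "finitely_many_arcs (\<lambda>r. u r / a) 0 T"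
proof -
  have "0 \<le> s \<longrightarrow> t \<le> T \<longrightarrow> finitely_many_arcs (\<lambda>r. u r / a) s t" if "s \<le> t" "0 \<le> s" "t \<le> T" for s t
    using that(1)
  proof (induct rule: Bolzano)
    case (trans a b c)
    then show ?case using finitely_many_arcs_trans by (meson order_trans)
  next
    case (local x)
    then have x: "x \<in> {0..T}" using that by auto
    obtain d1 where d1: "0 < d1" "\<And>t. x < t \<Longrightarrow> t < x + d1 \<Longrightarrow> t \<le> T \<Longrightarrow> constant_arc (\<lambda>r. u r / a) x t"
      using arc_right[OF x] by blast
    obtain d2 where d2: "0 < d2" "\<And>s. s < x \<Longrightarrow> x - d2 < s \<Longrightarrow> 0 \<le> s \<Longrightarrow> constant_arc (\<lambda>r. u r / a) s x"
      using arc_left[OF x] by blast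
    show ?case
    proof (intro exI conjI allI impI)
      show "0 < min d1 d2" using d1 d2 by simp
      fix p q assume pq: "p \<le> x \<and> x \<le> q \<and> q - p < min d1 d2" and "0 \<le> p" "q \<le> T"
      have "finitely_many_arcs (\<lambda>r. u r / a) p x"
        using d2(2)[of p] pq \<open>0 \<le> p\<close> finitely_many_arcs_refl finitely_many_arcs_arc by (cases "p = x") auto
      moreover have "finitely_many_arcs (\<lambda>r. u r / a) x q"
        using d1(2)[of q] pq \<open>q \<le> T\<close> finitely_many_arcs_refl finitely_many_arcs_arc by (cases "q = x") auto
      ultimately show "finitely_many_arcs (\<lambda>r. u r / a) p q" by (rule finitely_many_arcs_trans)
    qed
  qed
  then show ?thesis using T by simp
qed

lemma finitely_many_arcs_imp_switchings:
  assumes v: "finitely_many_arcs w 0 T" and eq: "AE t in lebesgue. t \<in> {0..T} \<longrightarrow> w t = v t"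
  shows "finitely_many_switchings T v"
proof -
  obtain n \<tau> where \<tau>: "\<tau> 0 = 0" "\<tau> n = T" "\<And>i. i < n \<Longrightarrow> \<tau> i < \<tau> (Suc i) \<and> constant_arc w (\<tau> i) (\<tau> (Suc i))"
    using v unfolding finitely_many_arcs_def by blast
  have mono: "\<tau> i \<le> \<tau> j" if "i \<le> j" "j \<le> n" for i j
    using that
  proof (induction j rule: dec_induct)
    case (step k)
    then have "\<tau> i \<le> \<tau> k" "\<tau> k < \<tau> (Suc k)" using \<tau>(3)[of k] by auto
    then show ?case by simp
  qed simp
  have "\<exists>c. c \<in> {1, -1, 0} \<and> (AE t in lebesgue. t \<in> {\<tau> i<..<\<tau> (Suc i)} \<longrightarrow> w t = c)" if "i < n" for i
    using \<tau>(3)[OF that] unfolding constant_arc_def by blast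
  then obtain c where c: "\<And>i. i < n \<Longrightarrow> c i \<in> {1, -1, 0}"
    "\<And>i. i < n \<Longrightarrow> AE t in lebesgue. t \<in> {\<tau> i<..<\<tau> (Suc i)} \<longrightarrow> w t = c i"
    by metis
  have "AE t in lebesgue_on {\<tau> i<..<\<tau> (Suc i)}. v t = c i" if i: "i < n" for i
  proof -
    have "0 \<le> \<tau> i" "\<tau> (Suc i) \<le> T" using mono[of 0 i] mono[of "Suc i" n] i \<tau>(1,2) by auto
    then have "AE t in lebesgue. t \<in> {\<tau> i<..<\<tau> (Suc i)} \<longrightarrow> v t = c i"
      by (intro eventually_elim2[OF c(2)[OF i] eq]) auto
    then show ?thesis by (subst AE_lebesgue_on_iff) auto
  qed
  then show ?thesis unfolding finitely_many_switchings_def using \<tau> c(1) by blast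
qed

text \<open>
  A reduction of the curvature bound is a process of (OC) with the same ends and smaller cost.
\<close>
lemma OC_optimal_not_reducible:
  assumes opt: "OC_optimal z0 zf \<theta>0 \<theta>f T x y \<theta> \<alpha> v" and T: "0 < T"
    and \<alpha>: "\<And>t. t \<in> {0..T} \<Longrightarrow> \<alpha> t = a" and curve: "curvature_curve T a u x y \<theta>"
  shows "\<not> reducible T a u \<theta>"
proof
  assume "reducible T a u \<theta>"
  then obtain a' h C where a': "0 < a'" "a' < a" and uh: "bounded_meas T a' (\<lambda>t. u t + h t)" and h: "bounded_meas T C h"
    and ends: "integral {0..T} h = 0"
     "integral {0..T} (\<lambda>t. cos (\<theta> t + integral {0..t} h)) = integral {0..T} (\<lambda>t. cos (\<theta> t))"
     "integral {0..T} (\<lambda>t. sin (\<theta> t + integral {0..t} h)) = integral {0..T} (\<lambda>t. sin (\<theta> t))"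
    unfolding reducible_def by blast
  have p: "primitive T \<theta> u" "primitive T x (\<lambda>t. cos (\<theta> t))" "primitive T y (\<lambda>t. sin (\<theta> t))"
    using curve by (simp_all add: curvature_curve_def)
  define \<theta>' where "\<theta>' t = \<theta> t + integral {0..t} h" for t
  define x' where "x' t = x 0 + integral {0..t} (\<lambda>t. cos (\<theta>' t))" for t
  define y' where "y' t = y 0 + integral {0..t} (\<lambda>t. sin (\<theta>' t))" for t
  have p': "primitive T \<theta>' (\<lambda>t. u t + h t)"
    unfolding \<theta>'_def by (intro primitive_add p primitive_integral[OF h])
  have c: "continuous_on {0..T} (\<lambda>t. cos (\<theta>' t))" "continuous_on {0..T} (\<lambda>t. sin (\<theta>' t))"
    by (intro continuous_intros primitive_continuous[OF p'])+
  obtain C1 C2 where C: "bounded_meas T C1 (\<lambda>t. cos (\<theta>' t))" "bounded_meas T C2 (\<lambda>t. sin (\<theta>' t))"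
    using bounded_meas_continuous[OF c(1)] bounded_meas_continuous[OF c(2)] by metis
  have "curvature_curve T a' (\<lambda>t. u t + h t) x' y' \<theta>'"
    using uh p' C unfolding curvature_curve_def primitive_def x'_def y'_def by auto
  moreover have "(x' 0, y' 0) = z0" "[\<theta>' 0 = \<theta>0] (rmod (2 * pi))" "[\<theta>' T = \<theta>f] (rmod (2 * pi))"
    using opt by (auto simp: OC_optimal_def OC_feasible_def x'_def y'_def \<theta>'_def ends)
  moreover have "x' T = x T" "y' T = y T"
    using primitive_diff[OF p(2), of 0 T] primitive_diff[OF p(3), of 0 T] T ends
    by (simp_all add: x'_def y'_def \<theta>'_def)
  then have "(x' T, y' T) = zf" using opt by (auto simp: OC_optimal_def OC_feasible_def)
  ultimately have "OC_feasible z0 zf \<theta>0 \<theta>f T x' y' \<theta>' (\<lambda>_. a') (\<lambda>t. (u t + h t) / a')"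
    using a' by (intro curve_imp_OC_feasible)
  then have "OC_cost T \<alpha> \<le> OC_cost T (\<lambda>_. a')" using opt unfolding OC_optimal_def by blast
  moreover have "OC_cost T \<alpha> = a * T" "OC_cost T (\<lambda>_. a') = a' * T"
    using \<alpha> T by (auto intro!: OC_cost_constant)
  ultimately show False using a' T by simp
qed

lemma OC_optimal_finitely_many_switchings:
  assumes opt: "OC_optimal z0 zf \<theta>0 \<theta>f T x y \<theta> \<alpha> v" and T: "0 < T"
  shows "finitely_many_switchings T v"
proof -
  have feasible: "OC_feasible z0 zf \<theta>0 \<theta>f T x y \<theta> \<alpha> v" using opt by (simp add: OC_optimal_def)
  show ?thesis
  proof (rule OC_feasible_imp_curve[OF feasible less_imp_le[OF T]])
    fix a u
    assume a: "a > 0" and \<alpha>: "\<And>t. t \<in> {0..T} \<Longrightarrow> \<alpha> t = a" and curve: "curvature_curve T a u x y \<theta>"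
      and uv: "AE t in lebesgue. t \<in> {0..T} \<longrightarrow> u t = a * v t"
    obtain p1 p2 \<psi> where \<psi>: "primitive T \<psi> (\<lambda>t. p1 * sin (\<theta> t) - p2 * cos (\<theta> t))"
      "p1 \<noteq> 0 \<or> p2 \<noteq> 0 \<or> (\<forall>t. \<psi> t \<noteq> 0)"
      "AE t in lebesgue. t \<in> {0..T} \<longrightarrow> \<psi> t * u t = a * \<bar>\<psi> t\<bar>"
      by (rule maximum_principle[OF T a curve OC_optimal_not_reducible[OF opt T \<alpha> curve]])
    interpret extremal T a p1 p2 u \<theta> \<psi>
      by unfold_locales (use a curve \<psi> in \<open>auto simp: curvature_curve_def\<close>)
    have "finitely_many_arcs (\<lambda>r. u r / a) 0 T"
      using T by (intro finitely_many_arcs_extremal) simp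
    moreover have "AE t in lebesgue. t \<in> {0..T} \<longrightarrow> u t / a = v t"
      using uv by (rule eventually_mono) (use a in auto)
    ultimately show ?thesis by (rule finitely_many_arcs_imp_switchings)
  qed
qed

theorem mainTheorem7:
  fixes z0 zf v0 vf :: "real \<times> real" and \<theta>0 \<theta>f T :: real
  assumes "v0 = (cos \<theta>0, sin \<theta>0)" and "vf = (cos \<theta>f, sin \<theta>f)"
    and "T > norm (z0 - zf)"
  shows "(\<forall>z z1 z2 v. P_solution z0 zf v0 vf T z z1 z2 \<and>
            control_of_curve z0 zf \<theta>0 \<theta>f T z z2 v \<longrightarrow> finitely_many_switchings T v) \<and>
         (\<forall>x y \<theta> \<alpha> v. OC_optimal z0 zf \<theta>0 \<theta>f T x y \<theta> \<alpha> v \<longrightarrow> finitely_many_switchings T v)"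
proof -
  have T: "0 < T" using assms(3) norm_ge_zero[of "z0 - zf"] by linarith
  show ?thesis
  proof (intro conjI allI impI)
    fix z z1 z2 v
    assume "P_solution z0 zf v0 vf T z z1 z2 \<and> control_of_curve z0 zf \<theta>0 \<theta>f T z z2 v"
    then obtain x y \<theta> \<alpha> where "OC_optimal z0 zf \<theta>0 \<theta>f T x y \<theta> \<alpha> v"
      using P_solution_imp_OC_optimal T unfolding assms(1,2) by metis
    then show "finitely_many_switchings T v" using T by (rule OC_optimal_finitely_many_switchings)
  next
    fix x y \<theta> \<alpha> v assume "OC_optimal z0 zf \<theta>0 \<theta>f T x y \<theta> \<alpha> v"
    then show "finitely_many_switchings T v" using T by (rule OC_optimal_finitely_many_switchings)
  qed
qed

end
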